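(* Let $k\ge2$, $q\ge1$ and let $F$ be a $(t-1)$-dimensional face of $T_{k,q}$. Then there exist a partition $\lambda=(\lambda_1,\ldots,\lambda_t)$ of $k$ into $t$ parts and, for each $i$, a partition $\sigma_i$ of $\lambda_i$, such that $\mathrm{link}_{T_{k,q}}(F)\cong K_{\sigma_1}*K_{\sigma_2}*\cdots*K_{\sigma_t}$; in this sense the link of $F$ corresponds to the pair $(\lambda,\{\sigma_1,\ldots,\sigma_t\})$ (the latter a multiset).
   Context: $R_{k,q}=\{\mathbf{x}\in\mathbb{R}^{k-1}:0\le x_1\le\cdots\le x_{k-1}\le q\}$, $W_{k,q}=R_{k,q}\cap\mathbb{Z}^{k-1}$. A permutation $\pi$ of $[k-1]$ is consistent with $\mathbf{v}\in W_{k,q}$ if $i$ precedes $i+1$ in $\pi$ whenever $v_i=v_{i+1}$; then $F(\mathbf{v},\pi)$ is the simplex with vertices $\mathbf{v}^{(1)}=\mathbf{v}$, $\mathbf{v}^{(m+1)}=\mathbf{v}^{(m)}+e_{\pi_{k-m}}$ ($m=1,\dots,k-1$). $T_{k,q}$ is the simplicial complex on $W_{k,q}$ whose facets are all such $F(\mathbf{v},\pi)$; $\mathrm{link}_K(\sigma)=\{\tau\in K:\sigma\cup\tau\in K,\sigma\cap\tau=\emptyset\}$. For a partition $\sigma=(\sigma_1,\ldots,\sigma_r)$ of $n$, $K_\sigma=\Delta(P_\sigma\setminus\{\hat0,\hat1\})$ where $P_\sigma=C_{\sigma_1}\times\cdots\times C_{\sigma_r}$, $C_m$ the chain $0<\cdots<m$;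 in particular $K_{(1)}=\{\emptyset\}$. $*$ denotes join. *)

theory Defs
  imports Main "HOL-Combinatorics.Permutations"
begin

text \<open>Simplicial complexes are abstract: a complex is the set of its faces (the empty face
  included), each face being the set of its vertices. Hence the vertex set of \<open>K\<close> is \<open>\<Union>K\<close>,
  and \<open>{{}}\<close> is the complex whose only face is empty.\<close>

definition complex_iso :: "'a set set \<Rightarrow> 'b set set \<Rightarrow> bool" (infix "\<cong>\<^sub>c" 50) where
  "K \<cong>\<^sub>c L \<longleftrightarrow> (\<exists>f. bij_betw f (\<Union>K) (\<Union>L) \<and> (\<lambda>\<sigma>. f ` \<sigma>) ` K = L)"

definition link :: "'a set set \<Rightarrow> 'a set \<Rightarrow> 'a set set" where
  "link K \<sigma> = {\<tau> \<in> K. \<sigma> \<union> \<tau> \<in> K \<and> \<sigma> \<inter> \<tau> = {}}"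

text \<open>The join of a finite list of complexes; tagging each vertex with the index of its
  complex makes the vertex sets disjoint.\<close>

definition join_list :: "'a set set list \<Rightarrow> (nat \<times> 'a) set set" where
  "join_list Ks = {Sigma {..<length Ks} \<tau> | \<tau>. \<forall>i<length Ks. \<tau> i \<in> Ks ! i}"

definition order_complex :: "'a set \<Rightarrow> ('a \<Rightarrow> 'a \<Rightarrow> bool) \<Rightarrow> 'a set set" where
  "order_complex A le = {C. C \<subseteq> A \<and> finite C \<and> Complete_Partial_Order.chain le C}"

definition is_partition :: "nat list \<Rightarrow> nat \<Rightarrow> bool" where
  "is_partition \<sigma> n \<longleftrightarrow> (\<forall>p \<in> set \<sigma>. 0 < p) \<and> sorted_wrt (\<ge>) \<sigma> \<and> sum_list \<sigma> = n"

text \<open>Elements of \<open>C\<^bsub>\<sigma>\<^sub>1\<^esub> \<times> \<dots> \<times> C\<^bsub>\<sigma>\<^sub>r\<^esub>\<close> are lists bounded entrywise by \<open>\<sigma>\<close>, ordered entrywise by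
  \<open>list_all2 (\<le>)\<close>; so the top element is \<open>\<sigma>\<close> itself.\<close>

definition chain_product :: "nat list \<Rightarrow> nat list set" where
  "chain_product \<sigma> = {x. length x = length \<sigma> \<and> (\<forall>i<length \<sigma>. x ! i \<in> {0..\<sigma> ! i})}"

definition K_part :: "nat list \<Rightarrow> nat list set set" where
  "K_part \<sigma> =
    order_complex (chain_product \<sigma> - {replicate (length \<sigma>) 0, \<sigma>}) (list_all2 (\<le>))"

lemma K_part_1: "K_part [1] = {{}}"
proof -
  have "chain_product [1] - {replicate (length [1::nat]) 0, [1]} = {}"
    by (auto simp: chain_product_def length_Suc_conv le_Suc_eq)
  then show ?thesis
    by (auto simp: K_part_def order_complex_def Complete_Partial_Order.chain_def)
qed

text \<open>A vector in \<open>\<int>\<^bsup>k-1\<^esup>\<close> is a function supported on the index set \<open>{1..k-1}\<close>.\<close>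

definition W :: "nat \<Rightarrow> nat \<Rightarrow> (nat \<Rightarrow> int) set" where
  "W k q = {v. (\<forall>i. i \<notin> {1..k-1} \<longrightarrow> v i = 0) \<and>
               0 \<le> v 1 \<and> (\<forall>i\<in>{1..<k-1}. v i \<le> v (i+1)) \<and> v (k-1) \<le> int q}"

text \<open>The permutation is in one-line notation \<open>\<pi> 1, \<dots>, \<pi> (k-1)\<close>, so \<open>inv \<pi> i\<close> is the position
  of \<open>i\<close>.\<close>

definition consistent :: "nat \<Rightarrow> (nat \<Rightarrow> int) \<Rightarrow> (nat \<Rightarrow> nat) \<Rightarrow> bool" where
  "consistent k v \<pi> \<longleftrightarrow> \<pi> permutes {1..k-1} \<and>
     (\<forall>i\<in>{1..<k-1}. v i = v (i+1) \<longrightarrow> inv \<pi> i < inv \<pi> (i+1))"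

text \<open>\<open>facet_vertex k v \<pi> m\<close> is the vertex \<open>v\<^bsup>(m+1)\<^esup>\<close>.\<close>

primrec facet_vertex :: "nat \<Rightarrow> (nat \<Rightarrow> int) \<Rightarrow> (nat \<Rightarrow> nat) \<Rightarrow> nat \<Rightarrow> nat \<Rightarrow> int" where
  "facet_vertex k v \<pi> 0 = v"
| "facet_vertex k v \<pi> (Suc m) =
     (\<lambda>j. facet_vertex k v \<pi> m j + (if j = \<pi> (k - Suc m) then 1 else 0))"

definition facet :: "nat \<Rightarrow> (nat \<Rightarrow> int) \<Rightarrow> (nat \<Rightarrow> nat) \<Rightarrow> (nat \<Rightarrow> int) set" where
  "facet k v \<pi> = facet_vertex k v \<pi> ` {0..k-1}"

text \<open>Consistency keeps the vertices monotone but does not bound the last coordinate: if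
  \<open>v (k-1) = q\<close>, the simplex leaves \<open>W k q\<close>. As the complex has vertex set \<open>W k q\<close>,
  such simplices are excluded.\<close>

definition T :: "nat \<Rightarrow> nat \<Rightarrow> (nat \<Rightarrow> int) set set" where
  "T k q = {F. \<exists>v \<pi>. v \<in> W k q \<and> consistent k v \<pi> \<and> facet k v \<pi> \<subseteq> W k q \<and> F \<subseteq> facet k v \<pi>}"

end

theory Submission
  imports Defs
begin

text \<open>Two vertices of \<open>T k q\<close> span an edge iff their difference, read on the coordinates \<open>0, \<dots>, k-1\<close>
  with coordinate \<open>0\<close> equal to zero, takes values in some \<open>{c, c+1}\<close>; and \<open>T k q\<close> is the clique complex of
  this graph. The relation is invariant under adding constants, and so are the inequalities
  \<open>x 0 \<le> x 1 \<le> \<dots> \<le> x (k-1) \<le> x 0 + q\<close> that define \<open>W k q\<close>. A face \<open>f 0 < \<dots> < f (t-1)\<close> therefore closes up to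
  a periodic chain with \<open>f t = f 0 + 1\<close>, whose steps raise the coordinates in disjoint blocks partitioning
  \<open>{0, \<dots>, k-1}\<close>; the block sizes form \<open>\<lambda>\<close>. A vertex of the link lies strictly between \<open>f i\<close> and \<open>f (i+1)\<close> for
  a unique \<open>i\<close> after adding a constant, and vertices from different gaps are always adjacent; this is the join.
  Inside a gap the vertices are \<open>f i\<close> raised on subsets of the block that are closed under the tight
  inequalities \<open>x j \<le> x (j+1)\<close>. Not all \<open>k\<close> cyclic inequalities are tight because \<open>q > 0\<close>, so the tight
  ones form disjoint paths and the closed subsets form a product of chains.\<close>

subsection \<open>Clique complexes\<close>

definition clique_complex :: "'a set \<Rightarrow> ('a \<Rightarrow> 'a \<Rightarrow> bool) \<Rightarrow> 'a set set" where
  "clique_complex V R = {\<tau>. \<tau> \<subseteq> V \<and> (\<forall>x\<in>\<tau>. \<forall>y\<in>\<tau>. R x y)}"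

lemma clique_complex_iso:
  assumes g: "bij_betw g V' V"
    and R: "\<And>x y. x \<in> V' \<Longrightarrow> y \<in> V' \<Longrightarrow> R' x y \<longleftrightarrow> R (g x) (g y)"
  shows "clique_complex V R \<cong>\<^sub>c clique_complex V' R'"
proof -
  define f where "f = inv_into V' g"
  have f: "bij_betw f V V'"
    unfolding f_def by (rule bij_betw_inv_into[OF g])
  have gf: "g (f x) = x" if "x \<in> V" for x
    unfolding f_def using bij_betw_inv_into_right[OF g that] .
  have fg: "f (g x) = x" if "x \<in> V'" for x
    unfolding f_def using bij_betw_inv_into_left[OF g that] .
  have fV: "f x \<in> V'" if "x \<in> V" for x using f that by (auto simp: bij_betw_def)
  have gV: "g x \<in> V" if "x \<in> V'" for x using g that by (auto simp: bij_betw_def)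
  have Rf: "R' (f x) (f y) \<longleftrightarrow> R x y" if "x \<in> V" "y \<in> V" for x y
    using R[OF fV fV, OF that] gf that by simp
  have image: "(\<lambda>\<sigma>. f ` \<sigma>) ` clique_complex V R = clique_complex V' R'"
  proof (intro subset_antisym subsetI)
    fix \<tau> assume "\<tau> \<in> (\<lambda>\<sigma>. f ` \<sigma>) ` clique_complex V R"
    then obtain \<sigma> where \<sigma>: "\<sigma> \<subseteq> V" "\<forall>x\<in>\<sigma>. \<forall>y\<in>\<sigma>. R x y" and \<tau>: "\<tau> = f ` \<sigma>"
      by (auto simp: clique_complex_def)
    have "R' (f x) (f y)" if "x \<in> \<sigma>" "y \<in> \<sigma>" for x y
      using that \<sigma> Rf[of x y] by blast
    then show "\<tau> \<in> clique_complex V' R'"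
      using \<sigma>(1) fV by (auto simp: clique_complex_def \<tau>)
  next
    fix \<tau> assume "\<tau> \<in> clique_complex V' R'"
    then have \<tau>: "\<tau> \<subseteq> V'" "\<forall>x\<in>\<tau>. \<forall>y\<in>\<tau>. R' x y"
      by (auto simp: clique_complex_def)
    have "R (g x) (g y)" if "x \<in> \<tau>" "y \<in> \<tau>" for x y
      using that \<tau> R[of x y] by blast
    then have "g ` \<tau> \<in> clique_complex V R"
      using \<tau>(1) gV by (auto simp: clique_complex_def)
    moreover have "\<tau> = f ` g ` \<tau>"
      using \<tau>(1) fg by (force simp: image_image)
    ultimately show "\<tau> \<in> (\<lambda>\<sigma>. f ` \<sigma>) ` clique_complex V R" by blast
  qed
  \<comment> \<open>\<open>R\<close> need not be reflexive, so some points of \<open>V\<close> may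
    not be vertices of the complex. The isomorphism is therefore \<open>f\<close> restricted to the
    union of the faces.\<close>
  have "\<Union>(clique_complex V R) \<subseteq> V" by (auto simp: clique_complex_def)
  then have "inj_on f (\<Union>(clique_complex V R))"
    using f by (auto simp: bij_betw_def intro: inj_on_subset)
  moreover have "f ` \<Union>(clique_complex V R) = \<Union>(clique_complex V' R')"
    unfolding image[symmetric] by blast
  ultimately show ?thesis
    unfolding complex_iso_def bij_betw_def using image by blast
qed

text \<open>Cliqueness is tested on pairs, so a set disjoint from \<open>F\<close> extends it as
  soon as each of its points does and it is a clique itself. Comparing links thus becomes comparing
  graphs.\<close>

lemma link_clique_complex:
  assumes F: "F \<in> clique_complex V R" and sym: "\<And>x y. R x y \<Longrightarrow> R y x"
  shows "link (clique_complex V R) F = clique_complex {x \<in> V. x \<notin> F \<and> (\<forall>y\<in>F. R x y)} R"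
proof (intro subset_antisym subsetI)
  fix \<tau> assume "\<tau> \<in> link (clique_complex V R) F"
  then show "\<tau> \<in> clique_complex {x \<in> V. x \<notin> F \<and> (\<forall>y\<in>F. R x y)} R"
    unfolding link_def clique_complex_def by blast
next
  fix \<tau> assume \<tau>: "\<tau> \<in> clique_complex {x \<in> V. x \<notin> F \<and> (\<forall>y\<in>F. R x y)} R"
  have "R x y" if "x \<in> F \<union> \<tau>" "y \<in> F \<union> \<tau>" for x y
    using that \<tau> F sym[of y x] unfolding clique_complex_def by blast
  then show "\<tau> \<in> link (clique_complex V R) F"
    using \<tau> F unfolding link_def clique_complex_def by blast
qed

section \<open>Joins of order complexes as clique complexes\<close>

lemma finite_chain_product: "finite (chain_product \<sigma>)"
proof (rule finite_subset)
  show "chain_product \<sigma> \<subseteq> {x. set x \<subseteq> {..sum_list \<sigma>} \<and> length x = length \<sigma>}"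
  proof
    fix x assume x: "x \<in> chain_product \<sigma>"
    have "x ! i \<le> sum_list \<sigma>" if "i < length \<sigma>" for i
    proof -
      have "x ! i \<le> \<sigma> ! i" using x that by (auto simp: chain_product_def)
      also have "\<dots> \<le> sum_list \<sigma>" using that by (simp add: elem_le_sum_list)
      finally show ?thesis .
    qed
    then show "x \<in> {x. set x \<subseteq> {..sum_list \<sigma>} \<and> length x = length \<sigma>}"
      using x by (auto simp: chain_product_def in_set_conv_nth)
  qed
qed (simp add: finite_lists_length_eq)

abbreviation proper_part :: "nat list \<Rightarrow> nat list set" where
  "proper_part \<sigma> \<equiv> chain_product \<sigma> - {replicate (length \<sigma>) 0, \<sigma>}"

text \<open>The edge relation, with loops, of the graph join of the comparability graphs.\<close>

definition tagged_comparable :: "nat \<times> nat list \<Rightarrow> nat \<times> nat list \<Rightarrow> bool" where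
  "tagged_comparable a b \<longleftrightarrow>
     (fst a = fst b \<longrightarrow> list_all2 (\<le>) (snd a) (snd b) \<or> list_all2 (\<le>) (snd b) (snd a))"

text \<open>Chains are cliques for comparability, and a join adds every edge between different tags.
  The finiteness required in \<open>order_complex\<close> comes from the finite ambient
  poset.\<close>

lemma join_K_part:
  "join_list (map K_part sig) =
     clique_complex (SIGMA i:{..<length sig}. proper_part (sig ! i)) tagged_comparable"
  (is "_ = clique_complex ?V _")
proof (intro subset_antisym subsetI)
  fix \<rho> assume "\<rho> \<in> join_list (map K_part sig)"
  then obtain \<tau> where \<rho>: "\<rho> = Sigma {..<length sig} \<tau>"
    and \<tau>: "\<forall>i<length sig. \<tau> i \<in> K_part (sig ! i)"
    by (auto simp: join_list_def)
  then show "\<rho> \<in> clique_complex ?V tagged_comparable"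
    by (fastforce simp: clique_complex_def K_part_def order_complex_def
        Complete_Partial_Order.chain_def tagged_comparable_def)
next
  fix \<rho> assume \<rho>: "\<rho> \<in> clique_complex ?V tagged_comparable"
  define \<tau> where "\<tau> = (\<lambda>i. {l. (i, l) \<in> \<rho>})"
  have "\<rho> = Sigma {..<length sig} \<tau>"
    using \<rho> by (auto simp: clique_complex_def \<tau>_def)
  moreover have "\<tau> i \<in> K_part (sig ! i)" if "i < length sig" for i
  proof -
    have sub: "\<tau> i \<subseteq> proper_part (sig ! i)"
      using \<rho> by (auto simp: clique_complex_def \<tau>_def)
    then have "finite (\<tau> i)"
      using finite_chain_product by (meson finite_Diff finite_subset)
    then show ?thesis
      using \<rho> sub by (fastforce simp: clique_complex_def K_part_def order_complex_def \<tau>_def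
        Complete_Partial_Order.chain_def tagged_comparable_def)
  qed
  ultimately show "\<rho> \<in> join_list (map K_part sig)"
    by (auto simp: join_list_def)
qed

subsection \<open>Up-sets of a disjoint union of paths\<close>

definition up_sets :: "'a set \<Rightarrow> ('a \<times> 'a) set \<Rightarrow> 'a set set" where
  "up_sets B E = {S. S \<subseteq> B \<and> (\<forall>(x, y)\<in>E. x \<in> S \<longrightarrow> y \<in> S)}"

lemma ex_source:
  assumes "finite E" "acyclic E" "D \<noteq> {}"
  shows "\<exists>a\<in>D. \<forall>x\<in>D. (x, a) \<notin> E"
proof -
  have "wf E" using assms by (simp add: finite_acyclic_wf)
  then show ?thesis using assms(3) by (metis wfE_min ex_in_conv)
qed

text \<open>Deleting a source of \<open>D\<close> leaves an up-set, so the size can be lowered one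
  at a time.\<close>

lemma up_set_of_card:
  assumes fin: "finite E" "acyclic E" and D: "D \<in> up_sets B E" "finite D" and n: "n \<le> card D"
  shows "\<exists>D' \<subseteq> D. D' \<in> up_sets B E \<and> card D' = n"
  using D n
proof (induction "card D" arbitrary: D)
  case 0
  then show ?case by auto
next
  case (Suc m)
  show ?case
  proof (cases "n = Suc m")
    case True
    then show ?thesis using Suc by auto
  next
    case False
    have "D \<noteq> {}" using Suc by auto
    from ex_source[OF fin this] obtain a where a: "a \<in> D" "\<And>x. x \<in> D \<Longrightarrow> (x, a) \<notin> E"
      by blast
    have "D - {a} \<in> up_sets B E" using Suc.prems(1) a by (auto simp: up_sets_def)
    moreover have "card (D - {a}) = m" using Suc a by simp
    ultimately have "\<exists>D'\<subseteq>D - {a}. D' \<in> up_sets B E \<and> card D' = n"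
      using Suc.prems Suc.hyps(2) False by (intro Suc.hyps(1)) auto
    then show ?thesis by blast
  qed
qed

text \<open>In-degree and out-degree are at most one and there is no cycle, so every component is a
  directed path.\<close>

locale path_forest =
  fixes B :: "'a set" and E :: "('a \<times> 'a) set"
  assumes finite_B: "finite B" and E_sub: "E \<subseteq> B \<times> B"
    and sv: "single_valued E" and inj: "single_valued (E\<inverse>)" and acyc: "acyclic E"
begin

definition sources :: "'a set" where
  "sources = {a \<in> B. \<forall>x. (x, a) \<notin> E}"

definition paths :: "'a set set" where
  "paths = (\<lambda>a. E\<^sup>* `` {a}) ` sources"

lemma finite_E: "finite E"
  using finite_B E_sub by (meson finite_SigmaI finite_subset)

lemma reach_B: "(a, x) \<in> E\<^sup>* \<Longrightarrow> a \<in> B \<Longrightarrow> x \<in> B"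
  by (induction rule: rtrancl_induct) (use E_sub in auto)

lemma path_sub: "C \<in> paths \<Longrightarrow> C \<subseteq> B"
  using reach_B by (auto simp: paths_def sources_def)

lemma path_closed: "C \<in> paths \<Longrightarrow> x \<in> C \<Longrightarrow> (x, y) \<in> E \<Longrightarrow> y \<in> C"
  by (auto simp: paths_def intro: rtrancl_into_rtrancl)

lemma path_ne: "C \<in> paths \<Longrightarrow> C \<noteq> {}"
  by (auto simp: paths_def)

lemma path_total: "C \<in> paths \<Longrightarrow> x \<in> C \<Longrightarrow> y \<in> C \<Longrightarrow> (x, y) \<in> E\<^sup>* \<or> (y, x) \<in> E\<^sup>*"
  using single_valued_confluent[OF sv] by (auto simp: paths_def)

lemma finite_paths: "finite paths"
  using finite_B by (auto simp: paths_def sources_def)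

lemma Union_paths: "\<Union>paths = B"
proof
  show "\<Union>paths \<subseteq> B" using path_sub by auto
  show "B \<subseteq> \<Union>paths"
  proof
    fix x assume x: "x \<in> B"
    \<comment> \<open>Walking back from \<open>x\<close>: a predecessor of a point that reaches
      \<open>x\<close> reaches \<open>x\<close> too, so a source of \<open>?D\<close> has no
      predecessor at all.\<close>
    let ?D = "{a \<in> B. (a, x) \<in> E\<^sup>*}"
    have "?D \<noteq> {}" using x by auto
    from ex_source[OF finite_E acyc this] obtain a
      where a: "a \<in> ?D" "\<And>y. y \<in> ?D \<Longrightarrow> (y, a) \<notin> E"
      by blast
    have "(y, a) \<notin> E" for y
    proof
      assume ya: "(y, a) \<in> E"
      then have "y \<in> ?D" using a(1) E_sub by (auto intro: converse_rtrancl_into_rtrancl)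
      then show False using a(2) ya by blast
    qed
    then have "a \<in> sources" using a(1) by (auto simp: sources_def)
    then show "x \<in> \<Union>paths" using a(1) by (auto simp: paths_def)
  qed
qed

lemma source_reach: "(x, a) \<in> E\<^sup>* \<Longrightarrow> a \<in> sources \<Longrightarrow> x = a"
  by (auto simp: sources_def elim: rtranclE)

text \<open>Walking backwards from a common point is deterministic, so one of the two sources
  reaches the other. Nothing enters a source, so they coincide.\<close>

lemma paths_disjoint:
  assumes "C \<in> paths" "C' \<in> paths" "C \<noteq> C'"
  shows "C \<inter> C' = {}"
proof (rule ccontr)
  assume "C \<inter> C' \<noteq> {}"
  then obtain a a' x where a: "a \<in> sources" "C = E\<^sup>* `` {a}" "a' \<in> sources" "C' = E\<^sup>* `` {a'}"
    and x: "(a, x) \<in> E\<^sup>*" "(a', x) \<in> E\<^sup>*"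
    using assms by (auto simp: paths_def)
  have "(x, a) \<in> (E\<inverse>)\<^sup>*" "(x, a') \<in> (E\<inverse>)\<^sup>*"
    using x by (auto simp: rtrancl_converse)
  from single_valued_confluent[OF inj this] have "(a', a) \<in> E\<^sup>* \<or> (a, a') \<in> E\<^sup>*"
    by (auto simp: rtrancl_converse)
  then have "a = a'" using source_reach a by blast
  then show False using a assms(3) by simp
qed

lemma up_set_reach: "(x, y) \<in> E\<^sup>* \<Longrightarrow> S \<in> up_sets B E \<Longrightarrow> x \<in> S \<Longrightarrow> y \<in> S"
  by (induction rule: rtrancl_induct) (auto simp: up_sets_def)

text \<open>An up-set meets a path in a final segment, and the final segments of a path are
  nested.\<close>

lemma up_sets_linear_on_path:
  assumes C: "C \<in> paths" and S: "S \<in> up_sets B E" "S' \<in> up_sets B E"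
  shows "S \<inter> C \<subseteq> S' \<inter> C \<or> S' \<inter> C \<subseteq> S \<inter> C"
proof (rule ccontr)
  assume "\<not> ?thesis"
  then obtain x y where "x \<in> S" "x \<in> C" "x \<notin> S'" "y \<in> S'" "y \<in> C" "y \<notin> S" by blast
  then show False
    using path_total[OF C, of x y] up_set_reach[OF _ S(1)] up_set_reach[OF _ S(2)] by metis
qed

lemma path_up_set: "C \<in> paths \<Longrightarrow> C \<in> up_sets B E"
  using path_closed path_sub by (auto simp: up_sets_def)

lemma finite_path: "C \<in> paths \<Longrightarrow> finite C"
  using path_sub finite_B by (meson finite_subset)

text \<open>Traces on a path are nested, so their sizes decide which is contained in which. The
  sizes thus serve as coordinates on the lattice of up-sets.\<close>

lemma up_sets_le_iff:
  assumes S: "S \<in> up_sets B E" "S' \<in> up_sets B E"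
  shows "S \<subseteq> S' \<longleftrightarrow> (\<forall>C\<in>paths. card (S \<inter> C) \<le> card (S' \<inter> C))"
proof
  assume "S \<subseteq> S'"
  then show "\<forall>C\<in>paths. card (S \<inter> C) \<le> card (S' \<inter> C)"
    using finite_path by (auto intro!: card_mono)
next
  assume le: "\<forall>C\<in>paths. card (S \<inter> C) \<le> card (S' \<inter> C)"
  have "S \<inter> C \<subseteq> S'" if C: "C \<in> paths" for C
  proof (cases "S \<inter> C \<subseteq> S' \<inter> C")
    case False
    then have "S' \<inter> C \<subseteq> S \<inter> C" using up_sets_linear_on_path[OF C S] by simp
    moreover have "finite (S \<inter> C)" "card (S \<inter> C) \<le> card (S' \<inter> C)"
      using finite_path[OF C] le C by auto
    ultimately have "S' \<inter> C = S \<inter> C" by (intro card_seteq)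
    then show ?thesis by blast
  qed blast
  moreover have "S \<subseteq> \<Union>paths" using S Union_paths by (auto simp: up_sets_def)
  ultimately show "S \<subseteq> S'" by blast
qed

text \<open>No edge joins different paths, so final segments of the prescribed sizes can be chosen
  independently and united.\<close>

lemma ex_up_set_with_cards:
  assumes n: "\<And>C. C \<in> paths \<Longrightarrow> n C \<le> card C"
  shows "\<exists>S\<in>up_sets B E. \<forall>C\<in>paths. card (S \<inter> C) = n C"
proof -
  have "\<forall>C\<in>paths. \<exists>D. D \<subseteq> C \<and> D \<in> up_sets B E \<and> card D = n C"
    using up_set_of_card[OF finite_E acyc path_up_set finite_path n] by blast
  then obtain D where D: "\<And>C. C \<in> paths \<Longrightarrow> D C \<subseteq> C \<and> D C \<in> up_sets B E \<and> card (D C) = n C"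
    by metis
  have "(\<Union>C\<in>paths. D C) \<in> up_sets B E"
    using D by (fastforce simp: up_sets_def)
  moreover have "(\<Union>C\<in>paths. D C) \<inter> C = D C" if "C \<in> paths" for C
    using paths_disjoint[OF that] D that by blast
  ultimately show ?thesis
    using D by (intro bexI[of _ "\<Union>C\<in>paths. D C"] ballI) simp_all
qed

text \<open>An up-set is coded by the sizes of its traces on the paths, the paths being listed by
  descending length to make \<open>\<sigma>\<close> a partition. The images of \<open>{}\<close> and
  \<open>B\<close> are recorded because \<open>K_part\<close> removes bottom and top.\<close>

lemma up_sets_iso_chain_product:
  "\<exists>\<sigma> h. is_partition \<sigma> (card B) \<and> bij_betw h (up_sets B E) (chain_product \<sigma>) \<and>
     (\<forall>S\<in>up_sets B E. \<forall>S'\<in>up_sets B E. S \<subseteq> S' \<longleftrightarrow> list_all2 (\<le>) (h S) (h S')) \<and>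
     h {} = replicate (length \<sigma>) 0 \<and> h B = \<sigma>"
proof -
  obtain cs0 where cs0: "set cs0 = paths" "distinct cs0"
    using finite_distinct_list[OF finite_paths] by blast
  define cs where "cs = rev (sort_key card cs0)"
  define \<sigma> where "\<sigma> = map card cs"
  define h where "h = (\<lambda>S. map (\<lambda>C. card (S \<inter> C)) cs)"
  have cs: "set cs = paths" "distinct cs" using cs0 by (auto simp: cs_def)
  have "sum_list \<sigma> = sum card paths"
    unfolding \<sigma>_def by (simp add: sum_list_distinct_conv_sum_set cs)
  also have "\<dots> = card (\<Union>paths)"
    using paths_disjoint finite_path by (intro card_Union_disjoint[symmetric])
      (auto simp: pairwise_def disjnt_def)
  finally have "sum_list \<sigma> = card B" by (simp add: Union_paths)
  moreover have "sorted_wrt (\<ge>) \<sigma>"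
  proof -
    have "sorted (map card (sort_key card cs0))" by simp
    then show ?thesis unfolding \<sigma>_def cs_def by (simp add: rev_map[symmetric] sorted_wrt_rev)
  qed
  moreover have "\<forall>p\<in>set \<sigma>. 0 < p"
    using path_ne finite_path by (auto simp: \<sigma>_def cs card_gt_0_iff)
  ultimately have part: "is_partition \<sigma> (card B)" by (simp add: is_partition_def)
  have le: "S \<subseteq> S' \<longleftrightarrow> list_all2 (\<le>) (h S) (h S')"
    if "S \<in> up_sets B E" "S' \<in> up_sets B E" for S S'
    by (simp add: up_sets_le_iff[OF that] h_def list_all2_conv_all_nth flip: cs(1)
        add: all_set_conv_all_nth)
  have h_inj: "inj_on h (up_sets B E)"
  proof (rule inj_onI)
    fix S S' assume "S \<in> up_sets B E" "S' \<in> up_sets B E" "h S = h S'"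
    then show "S = S'"
      using le[of S S'] le[of S' S] by (simp add: list_all2_refl subset_antisym)
  qed
  have h_image: "h ` up_sets B E = chain_product \<sigma>"
  proof (intro subset_antisym subsetI)
    fix l assume "l \<in> h ` up_sets B E"
    then obtain S where l: "l = h S" by blast
    have "card (S \<inter> cs ! i) \<le> card (cs ! i)" if "i < length cs" for i
      using finite_path cs(1) nth_mem[OF that] by (intro card_mono) auto
    then show "l \<in> chain_product \<sigma>"
      by (simp add: l h_def \<sigma>_def chain_product_def)
  next
    fix l assume l: "l \<in> chain_product \<sigma>"
    then have len: "length l = length cs" by (simp add: chain_product_def \<sigma>_def)
    \<comment> \<open>Reads the list \<open>l\<close> as a function on paths; \<open>cs\<close> is
      distinct, so each path has exactly one index.\<close>
    define n where "n = (\<lambda>C. l ! (THE i. i < length cs \<and> cs ! i = C))"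
    have n: "n (cs ! i) = l ! i" if "i < length cs" for i
    proof -
      have "(THE i'. i' < length cs \<and> cs ! i' = cs ! i) = i"
        using that nth_eq_iff_index_eq[OF cs(2)] by (intro the_equality) blast+
      then show ?thesis by (simp add: n_def)
    qed
    have "n C \<le> card C" if C: "C \<in> paths" for C
    proof -
      obtain i where i: "i < length cs" "C = cs ! i"
        using C by (auto simp: cs(1)[symmetric] in_set_conv_nth)
      then have "l ! i \<le> \<sigma> ! i" using l by (simp add: chain_product_def \<sigma>_def)
      then show ?thesis using n[OF i(1)] i by (simp add: \<sigma>_def)
    qed
    from ex_up_set_with_cards[OF this] obtain S
      where S: "S \<in> up_sets B E" "\<And>C. C \<in> paths \<Longrightarrow> card (S \<inter> C) = n C" by blast
    have "h S = l"
    proof (rule nth_equalityI)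
      show "length (h S) = length l" by (simp add: h_def len)
      show "h S ! i = l ! i" if "i < length (h S)" for i
        using that S(2)[of "cs ! i"] n[of i] nth_mem[of i cs] cs(1) by (simp add: h_def)
    qed
    then show "l \<in> h ` up_sets B E" using S by blast
  qed
  have h0: "h {} = replicate (length \<sigma>) 0"
    by (simp add: h_def \<sigma>_def map_replicate_const)
  have h1: "h B = \<sigma>"
    using path_sub cs(1) by (auto simp: h_def \<sigma>_def Int_absorb1)
  show ?thesis
    by (intro exI[of _ \<sigma>] exI[of _ h] conjI ballI bij_betw_imageI part h_inj h_image h0 h1 le)
qed

end

subsection \<open>\<open>T k q\<close> as a clique complex\<close>

definition nxt :: "nat \<Rightarrow> nat \<Rightarrow> nat" where
  "nxt k j = (if Suc j < k then Suc j else 0)"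

text \<open>The offset \<open>q\<close> sits on the step from \<open>k-1\<close> back to
  \<open>0\<close>, so that the upper bound on the last coordinate takes the same form as the
  monotonicity conditions.\<close>

definition wrap :: "nat \<Rightarrow> nat \<Rightarrow> nat \<Rightarrow> int" where
  "wrap k q j = (if Suc j < k then 0 else int q)"

definition cyclic_mono :: "nat \<Rightarrow> nat \<Rightarrow> (nat \<Rightarrow> int) \<Rightarrow> bool" where
  "cyclic_mono k q x \<longleftrightarrow> (\<forall>j<k. x j \<le> x (nxt k j) + wrap k q j)"

text \<open>The oscillation of \<open>x - y\<close> is at most one. Quantifying over ordered pairs
  avoids naming the constant \<open>c\<close> and makes symmetry and translation invariance
  immediate.\<close>

definition compat :: "nat \<Rightarrow> (nat \<Rightarrow> int) \<Rightarrow> (nat \<Rightarrow> int) \<Rightarrow> bool" where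
  "compat k x y \<longleftrightarrow> (\<forall>i<k. \<forall>j<k. (x i - y i) - (x j - y j) \<le> 1)"

text \<open>The representative modulo constant vectors that vanishes at coordinate \<open>0\<close>;
  the value zero from \<open>k\<close> on matches the support condition of \<open>W\<close>.\<close>

definition normalise :: "nat \<Rightarrow> (nat \<Rightarrow> int) \<Rightarrow> nat \<Rightarrow> int" where
  "normalise k y = (\<lambda>j. if j < k then y j - y 0 else 0)"

lemma nxt_less: "0 < k \<Longrightarrow> nxt k j < k"
  by (simp add: nxt_def)

lemma nxt_inj: "i < k \<Longrightarrow> j < k \<Longrightarrow> nxt k i = nxt k j \<Longrightarrow> i = j"
  by (auto simp: nxt_def split: if_splits)

lemma compat_sym: "compat k x y \<Longrightarrow> compat k y x"
  unfolding compat_def by (smt (verit))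

lemma compat_between:
  assumes "\<And>j. j < k \<Longrightarrow> x j \<le> y j" "\<And>j. j < k \<Longrightarrow> y j \<le> x j + 1"
  shows "compat k x y"
  unfolding compat_def using assms by (smt (verit))

lemma compat_normalise: "0 < k \<Longrightarrow> compat k (normalise k x) y \<longleftrightarrow> compat k x y"
  by (simp add: compat_def normalise_def algebra_simps)

lemma compat_normalise2: "0 < k \<Longrightarrow> compat k x (normalise k y) \<longleftrightarrow> compat k x y"
  using compat_normalise[of k y x] compat_sym by blast

lemma cyclic_mono_normalise: "0 < k \<Longrightarrow> cyclic_mono k q (normalise k x) \<longleftrightarrow> cyclic_mono k q x"
  by (simp add: cyclic_mono_def normalise_def nxt_less)

lemma cyclic_mono_cong:
  "0 < k \<Longrightarrow> (\<And>j. j < k \<Longrightarrow> x j = y j) \<Longrightarrow> cyclic_mono k q x \<longleftrightarrow> cyclic_mono k q y"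
  by (simp add: cyclic_mono_def nxt_less)

text \<open>Once \<open>x 0 = 0\<close>, the cyclic inequalities at the indices \<open>0\<close> and
  \<open>k-1\<close> are the lower bound on \<open>x 1\<close> and the upper bound on
  \<open>x (k-1)\<close>.\<close>

lemma W_iff:
  assumes "k \<ge> 2"
  shows "x \<in> W k q \<longleftrightarrow> (\<forall>j. j \<notin> {1..k-1} \<longrightarrow> x j = 0) \<and> cyclic_mono k q x"
proof -
  have "(0 \<le> x 1 \<and> (\<forall>i\<in>{1..<k-1}. x i \<le> x (i+1)) \<and> x (k-1) \<le> int q) \<longleftrightarrow> cyclic_mono k q x"
    if x0: "x 0 = 0"
  proof
    assume x: "0 \<le> x 1 \<and> (\<forall>i\<in>{1..<k-1}. x i \<le> x (i+1)) \<and> x (k-1) \<le> int q"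
    show "cyclic_mono k q x"
      unfolding cyclic_mono_def
    proof (intro allI impI)
      fix j assume "j < k"
      then consider "j = 0" | "j \<in> {1..<k-1}" | "j = k - 1" by fastforce
      then show "x j \<le> x (nxt k j) + wrap k q j"
        by cases (use x x0 assms in \<open>auto simp: nxt_def wrap_def\<close>)
    qed
  next
    assume x: "cyclic_mono k q x"
    then have step: "j < k \<Longrightarrow> x j \<le> x (nxt k j) + wrap k q j" for j
      by (auto simp: cyclic_mono_def)
    show "0 \<le> x 1 \<and> (\<forall>i\<in>{1..<k-1}. x i \<le> x (i+1)) \<and> x (k-1) \<le> int q"
    proof (intro conjI ballI)
      show "0 \<le> x 1" using step[of 0] x0 assms by (simp add: nxt_def wrap_def)
      show "x i \<le> x (i+1)" if "i \<in> {1..<k-1}" for i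
      proof -
        have "i < k" "Suc i < k" using that by auto
        then show ?thesis using step[of i] by (simp add: nxt_def wrap_def)
      qed
      show "x (k-1) \<le> int q"
        using step[of "k-1"] x0 assms by (simp add: nxt_def wrap_def)
    qed
  qed
  then show ?thesis by (auto simp: W_def)
qed

lemma normalise_W: "k \<ge> 2 \<Longrightarrow> normalise k y \<in> W k q \<longleftrightarrow> cyclic_mono k q y"
  by (simp add: W_iff cyclic_mono_normalise) (auto simp: normalise_def not_le)

lemma normalise_id: "k \<ge> 2 \<Longrightarrow> x \<in> W k q \<Longrightarrow> normalise k x = x"
  by (fastforce simp: W_def normalise_def)

lemma W_bounds:
  assumes k: "k \<ge> 2" and x: "x \<in> W k q"
  shows "0 \<le> x j" "x j \<le> int q"
proof -
  have "0 \<le> x j \<and> x j \<le> int q"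
  proof (cases "j \<in> {1..k-1}")
    case False
    then show ?thesis using x by (simp add: W_def)
  next
    case True
    have mono: "x i \<le> x (Suc i)" if "1 \<le> i" "i < k - 1" for i
      using x that by (auto simp: W_def)
    have "1 \<le> j" "j \<le> k - 1" using True by auto
    then have "0 \<le> x j"
    proof (induction j rule: dec_induct)
      case base
      then show ?case using x by (auto simp: W_def)
    next
      case (step n)
      then show ?case using mono[of n] by simp
    qed
    moreover from \<open>j \<le> k - 1\<close> \<open>1 \<le> j\<close> have "x j \<le> int q"
    proof (induction j rule: inc_induct)
      case base
      then show ?case using x by (auto simp: W_def)
    next
      case (step n)
      then show ?case using mono[of n] by simp
    qed
    ultimately show ?thesis by blast
  qed
  then show "0 \<le> x j" "x j \<le> int q" by auto
qed

lemma finite_W: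
  assumes "k \<ge> 2"
  shows "finite (W k q)"
proof (rule finite_subset)
  show "W k q \<subseteq> {x. \<forall>j. (j \<in> {1..k-1} \<longrightarrow> x j \<in> {0..int q}) \<and> (j \<notin> {1..k-1} \<longrightarrow> x j = 0)}"
  proof
    fix x assume x: "x \<in> W k q"
    have "0 \<le> x j \<and> x j \<le> int q" "j \<notin> {1..k-1} \<longrightarrow> x j = 0" for j
      using W_bounds[OF assms x, of j] x by (auto simp: W_def)
    then show "x \<in> {x. \<forall>j. (j \<in> {1..k-1} \<longrightarrow> x j \<in> {0..int q}) \<and> (j \<notin> {1..k-1} \<longrightarrow> x j = 0)}"
      by simp
  qed
qed (intro finite_set_of_finite_funs; simp)

text \<open>Both vectors vanish at coordinate \<open>0\<close>, so the difference takes the value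
  zero there and, having oscillation at most one, cannot take both signs. Faces are therefore
  chains.\<close>

lemma compat_comparable:
  assumes k: "k \<ge> 2" and x: "x \<in> W k q" "y \<in> W k q" "compat k x y"
  shows "x \<le> y \<or> y \<le> x" "x j \<le> y j + 1"
proof -
  have c: "(x i - y i) - (x j - y j) \<le> 1" if "i < k" "j < k" for i j
    using x(3) that by (auto simp: compat_def)
  have x0: "x i = 0" "y i = 0" if "i \<notin> {1..k-1}" for i
    using x(1,2) that by (auto simp: W_def)
  show "x j \<le> y j + 1"
    using c[of j 0] x0[of 0] x0[of j] k by (cases "j < k") auto
  show "x \<le> y \<or> y \<le> x"
  proof (rule ccontr)
    assume "\<not> ?thesis"
    then obtain i j where ij: "x i > y i" "x j < y j" by (auto simp: le_fun_def not_le)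
    then have "i < k" "j < k" using x0[of i] x0[of j] by (force, force)
    then show False using c[of i j] ij by simp
  qed
qed

section \<open>Facets and cliques\<close>

lemma facet_vertex_eq:
  assumes k: "k \<ge> 1" and \<pi>: "\<pi> permutes {1..k-1}" and m: "m \<le> k - 1"
  shows "facet_vertex k v \<pi> m = (\<lambda>j. v j + (if j \<in> \<pi> ` {k-m..k-1} then 1 else 0))"
  using m
proof (induction m)
  case 0
  then show ?case using k by simp
next
  case (Suc m)
  have "{k - Suc m..k-1} = insert (k - Suc m) {k-m..k-1}" using Suc.prems by auto
  \<comment> \<open>By injectivity of \<open>\<pi>\<close> the coordinate raised now has not been
    raised before, so indicators suffice.\<close>
  moreover have "\<pi> (k - Suc m) \<notin> \<pi> ` {k-m..k-1}"
    using permutes_inj[OF \<pi>] Suc.prems by (auto simp: inj_image_mem_iff)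
  ultimately show ?case using Suc by (auto simp: fun_eq_iff)
qed

lemma facet_vertex_compat:
  assumes k: "k \<ge> 1" and \<pi>: "\<pi> permutes {1..k-1}" and m: "m \<le> m'" "m' \<le> k - 1"
  shows "compat k (facet_vertex k v \<pi> m) (facet_vertex k v \<pi> m')"
proof (rule compat_between)
  have "\<pi> ` {k-m..k-1} \<subseteq> \<pi> ` {k-m'..k-1}" using m by (intro image_mono) auto
  then show "facet_vertex k v \<pi> m j \<le> facet_vertex k v \<pi> m' j"
    "facet_vertex k v \<pi> m' j \<le> facet_vertex k v \<pi> m j + 1" for j
    using m by (auto simp: facet_vertex_eq[OF k \<pi>])
qed

lemma T_imp_clique:
  assumes k: "k \<ge> 1"
  shows "T k q \<subseteq> clique_complex (W k q) (compat k)"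
proof
  fix F assume "F \<in> T k q"
  then obtain v \<pi> where \<pi>: "\<pi> permutes {1..k-1}" and sub: "facet k v \<pi> \<subseteq> W k q" "F \<subseteq> facet k v \<pi>"
    by (auto simp: T_def consistent_def)
  have "compat k x y" if xy: "x \<in> F" "y \<in> F" for x y
  proof -
    have "x \<in> facet_vertex k v \<pi> ` {0..k-1}" "y \<in> facet_vertex k v \<pi> ` {0..k-1}"
      using xy sub(2) by (auto simp: facet_def)
    then obtain m m' where "x = facet_vertex k v \<pi> m" "m \<in> {0..k-1}"
      and "y = facet_vertex k v \<pi> m'" "m' \<in> {0..k-1}"
      by blast
    then have m: "x = facet_vertex k v \<pi> m" "y = facet_vertex k v \<pi> m'" "m \<le> k - 1" "m' \<le> k - 1"
      by simp_all
    show ?thesis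
    proof (cases "m \<le> m'")
      case True
      then show ?thesis unfolding m using facet_vertex_compat[OF k \<pi>] m by blast
    next
      case False
      then have "m' \<le> m" by simp
      then show ?thesis unfolding m using compat_sym facet_vertex_compat[OF k \<pi>] m by blast
    qed
  qed
  then show "F \<in> clique_complex (W k q) (compat k)"
    using sub by (auto simp: clique_complex_def)
qed

lemma ex_sorting_permutation:
  fixes \<kappa> :: "nat \<Rightarrow> int"
  assumes "inj_on \<kappa> {1..n}"
  shows "\<exists>\<pi>. \<pi> permutes {1..n} \<and> (\<forall>i\<in>{1..n}. \<forall>j\<in>{1..n}. i < j \<longrightarrow> \<kappa> (\<pi> i) < \<kappa> (\<pi> j))"
proof -
  define xs where "xs = sort_key \<kappa> [1..<Suc n]"
  have xs: "set xs = {1..n}" "distinct xs" "length xs = n"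
    by (auto simp: xs_def)
  have "sorted_wrt (<) (map \<kappa> xs)"
    using assms xs by (simp add: strict_sorted_iff distinct_map) (simp add: xs_def)
  then have less: "\<kappa> (xs ! i) < \<kappa> (xs ! j)" if "i < j" "j < n" for i j
    using sorted_wrt_nth_less[of "(<)" "map \<kappa> xs" i j] that xs by simp
  \<comment> \<open>List positions start at 0 and those of \<open>\<pi>\<close> at 1; outside
    \<open>{1..n}\<close> a permutation has to be the identity.\<close>
  define \<pi> where "\<pi> = (\<lambda>i. if i \<in> {1..n} then xs ! (i - 1) else i)"
  have "bij_betw (\<lambda>i. i - 1) {1..n} {..<n}"
    by (rule bij_betw_byWitness[where f' = Suc]) auto
  moreover have "bij_betw ((!) xs) {..<n} {1..n}"
    using bij_betw_nth[OF xs(2)] xs by auto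
  ultimately have "bij_betw ((!) xs \<circ> (\<lambda>i. i - 1)) {1..n} {1..n}"
    by (rule bij_betw_trans)
  then have "bij_betw \<pi> {1..n} {1..n}"
    by (rule bij_betw_cong[THEN iffD1, rotated]) (simp add: \<pi>_def)
  then have "\<pi> permutes {1..n}" by (rule bij_imp_permutes) (auto simp: \<pi>_def)
  moreover have "\<kappa> (\<pi> i) < \<kappa> (\<pi> j)" if "i \<in> {1..n}" "j \<in> {1..n}" "i < j" for i j
    using less[of "i - 1" "j - 1"] that by (simp add: \<pi>_def)
  ultimately show ?thesis by blast
qed

text \<open>Keys increase along \<open>\<pi>\<close>, so a set closed under larger keys fills a
  final interval of positions. These are the sets of coordinates raised in the vertices of a
  facet.\<close>

lemma sorted_up_set_is_suffix:
  fixes \<kappa> :: "nat \<Rightarrow> int"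
  assumes k: "k \<ge> 1" and \<pi>: "\<pi> permutes {1..k-1}"
    and sorted: "\<And>i j. i \<in> {1..k-1} \<Longrightarrow> j \<in> {1..k-1} \<Longrightarrow> i < j \<Longrightarrow> \<kappa> (\<pi> i) < \<kappa> (\<pi> j)"
    and U: "U \<subseteq> {1..k-1}" "\<And>i j. i \<in> U \<Longrightarrow> j \<in> {1..k-1} \<Longrightarrow> \<kappa> i < \<kappa> j \<Longrightarrow> j \<in> U"
  shows "\<exists>m\<le>k-1. U = \<pi> ` {k-m..k-1}"
proof (cases "U = {}")
  case True
  then show ?thesis using k by (intro exI[of _ 0]) auto
next
  case False
  define P where "P = {p \<in> {1..k-1}. \<pi> p \<in> U}"
  have image: "\<pi> ` P = U"
  proof -
    have "U \<subseteq> \<pi> ` {1..k-1}" using U(1) permutes_image[OF \<pi>] by simp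
    then show ?thesis by (auto simp: P_def)
  qed
  then have "finite P" "P \<noteq> {}" using False by (auto simp: P_def)
  define p where "p = Min P"
  have p: "p \<in> P" "\<And>i. i \<in> P \<Longrightarrow> p \<le> i"
    using \<open>finite P\<close> \<open>P \<noteq> {}\<close> by (auto simp: p_def)
  have "P = {p..k-1}"
  proof (intro subset_antisym subsetI)
    fix i assume i: "i \<in> {p..k-1}"
    then have i1: "i \<in> {1..k-1}" using p(1) by (auto simp: P_def)
    show "i \<in> P"
    proof (cases "i = p")
      case False
      have "\<pi> i \<in> {1..k-1}" using i1 permutes_in_image[OF \<pi>] by blast
      then have "\<pi> i \<in> U"
        using U(2)[of "\<pi> p" "\<pi> i"] sorted[of p i] p(1) i i1 False by (auto simp: P_def)
      then show ?thesis using i1 by (simp add: P_def)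
    qed (use p in simp)
  qed (use p in \<open>auto simp: P_def\<close>)
  moreover have "k - (k - p) = p" "k - p \<le> k - 1" using p(1) by (auto simp: P_def)
  ultimately show ?thesis using image by metis
qed

text \<open>\<open>\<pi>\<close> is read from its end, so consistency raises the right one of two
  equal neighbours first and monotonicity survives. The last coordinate starts below
  \<open>q\<close> and is raised at most once.\<close>

lemma consistent_facet_in_W:
  assumes k: "k \<ge> 2" and v: "v \<in> W k q" "v (k-1) < int q" and \<pi>: "consistent k v \<pi>"
  shows "facet k v \<pi> \<subseteq> W k q"
proof -
  have k1: "k \<ge> 1" using k by simp
  have perm: "\<pi> permutes {1..k-1}" using \<pi> by (simp add: consistent_def)
  have "facet_vertex k v \<pi> m \<in> W k q" if m: "m \<le> k - 1" for m
  proof -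
    let ?A = "\<pi> ` {k-m..k-1}"
    have inv: "j \<in> ?A \<longleftrightarrow> inv \<pi> j \<in> {k-m..k-1}" for j
    proof
      assume "j \<in> ?A"
      then show "inv \<pi> j \<in> {k-m..k-1}" using permutes_inverses(2)[OF perm] by force
    next
      assume "inv \<pi> j \<in> {k-m..k-1}"
      then have "\<pi> (inv \<pi> j) \<in> ?A" by (rule imageI)
      then show "j \<in> ?A" by (simp only: permutes_inverses(1)[OF perm])
    qed
    have A: "?A \<subseteq> {1..k-1}"
    proof -
      have "?A \<subseteq> \<pi> ` {1..k-1}" using m k by (intro image_mono) auto
      then show ?thesis by (simp only: permutes_image[OF perm])
    qed
    have up: "i + 1 \<in> ?A" if i: "i \<in> {1..<k-1}" "v i = v (i+1)" "i \<in> ?A" for i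
    proof -
      have "inv \<pi> i < inv \<pi> (i+1)" using \<pi> i by (auto simp: consistent_def)
      moreover have "inv \<pi> (i+1) \<in> {1..k-1}"
        using i permutes_in_image[OF permutes_inv[OF perm]] by auto
      ultimately show ?thesis using i(3) unfolding inv by auto
    qed
    have mono: "v i + (if i \<in> ?A then 1 else 0) \<le> v (i+1) + (if i+1 \<in> ?A then 1 else 0)"
      if i: "i \<in> {1..<k-1}" for i
    proof -
      have "v i \<le> v (i+1)" using v(1) i by (auto simp: W_def)
      then show ?thesis using up[OF i] by (cases "v i = v (i+1)") auto
    qed
    show ?thesis
      unfolding W_def mem_Collect_eq facet_vertex_eq[OF k1 perm m]
    proof (intro conjI ballI allI impI mono)
      show "v i + (if i \<in> ?A then 1 else 0) = 0" if "i \<notin> {1..k-1}" for i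
        using that A v(1) by (auto simp: W_def)
      show "0 \<le> v 1 + (if 1 \<in> ?A then 1 else 0)" using v(1) by (simp add: W_def)
      show "v (k-1) + (if k-1 \<in> ?A then 1 else 0) \<le> int q" using v(2) by simp
    qed
  qed
  then show ?thesis by (auto simp: facet_def)
qed

lemma clique_imp_T:
  assumes k: "k \<ge> 2" and q: "q \<ge> 1" and F: "F \<subseteq> W k q" "\<And>x y. x \<in> F \<Longrightarrow> y \<in> F \<Longrightarrow> compat k x y"
    and ne: "F \<noteq> {}"
  shows "F \<in> T k q"
proof -
  have k1: "k \<ge> 1" using k by simp
  have fin: "finite F" using F finite_W[OF k] by (meson finite_subset)
  have cmp: "x \<le> y \<or> y \<le> x" and le1: "x j \<le> y j + 1" if "x \<in> F" "y \<in> F" for x y j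
    using compat_comparable[OF k _ _ F(2)[OF that]] F(1) that by (meson subsetD)+
  obtain a where a: "a \<in> F" "\<And>x. x \<in> F \<Longrightarrow> x \<le> a \<Longrightarrow> a = x"
    using finite_has_minimal[OF fin ne] by blast
  have least: "a j \<le> x j" if "x \<in> F" for x j
    using cmp[OF a(1) that] a(2)[OF that] by (auto simp: le_fun_def)
  \<comment> \<open>The least vertex \<open>a\<close> may have last coordinate \<open>q\<close>, and
    a facet based there would leave \<open>W k q\<close>. Truncating at \<open>q - 1\<close> repairs
    this, and \<open>F\<close> still lies between \<open>v\<close> and \<open>v + 1\<close> because
    no coordinate exceeds \<open>q\<close>.\<close>
  define v where "v = (\<lambda>j. min (a j) (int q - 1))"
  have v: "v \<in> W k q"
  proof -
    have "a \<in> W k q" using a F by blast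
    then show ?thesis using q by (auto simp: W_def v_def intro: min.coboundedI1)
  qed
  have vq: "v (k-1) < int q" by (simp add: v_def)
  have v_le: "v j \<le> x j" "x j \<le> v j + 1" if "x \<in> F" for x j
  proof -
    show "v j \<le> x j" using least[OF that, of j] by (simp add: v_def)
    have "x j \<le> int q" using W_bounds[OF k] F that by blast
    then show "x j \<le> v j + 1" using le1[OF that a(1), of j] by (simp add: v_def)
  qed
  \<comment> \<open>\<open>\<tau> j\<close> is the time at which the chain \<open>F\<close> raises coordinate \<open>j\<close>; coordinates raised early come
    late in \<open>\<pi>\<close>, and ties are broken as consistency demands.\<close>
  define \<tau> where "\<tau> = (\<lambda>j. card {x \<in> F. x j = v j})"
  define \<kappa> where "\<kappa> = (\<lambda>j. int j - int k * int (\<tau> j))"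
  \<comment> \<open>Indices in \<open>{1..k-1}\<close> differ by less than \<open>k\<close>, so the
    factor \<open>k\<close> lets \<open>\<tau>\<close> decide before the index does.\<close>
  have \<tau>_le: "\<tau> j \<le> \<tau> i" if "i \<in> {1..k-1}" "j \<in> {1..k-1}" "\<kappa> i \<le> \<kappa> j" for i j
  proof (rule ccontr)
    assume "\<not> ?thesis"
    then have "int (\<tau> i) + 1 \<le> int (\<tau> j)" by simp
    then have "int k * (int (\<tau> i) + 1) \<le> int k * int (\<tau> j)" by (intro mult_left_mono) auto
    then show False using that by (simp add: \<kappa>_def algebra_simps)
  qed
  have "inj_on \<kappa> {1..k-1}"
  proof (rule inj_onI)
    fix i j assume "i \<in> {1..k-1}" "j \<in> {1..k-1}" "\<kappa> i = \<kappa> j"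
    then show "i = j" using \<tau>_le[of i j] \<tau>_le[of j i] by (simp add: \<kappa>_def)
  qed
  from ex_sorting_permutation[OF this] obtain \<pi> where \<pi>: "\<pi> permutes {1..k-1}"
    and sorted: "\<And>i j. i \<in> {1..k-1} \<Longrightarrow> j \<in> {1..k-1} \<Longrightarrow> i < j \<Longrightarrow> \<kappa> (\<pi> i) < \<kappa> (\<pi> j)"
    by blast
  have cons: "consistent k v \<pi>"
    unfolding consistent_def
  proof (intro conjI ballI impI \<pi>)
    fix i assume i: "i \<in> {1..<k-1}" "v i = v (i+1)"
    \<comment> \<open>From equal values, a monotone vertex that raises \<open>i\<close> also raises
      \<open>i+1\<close>; hence \<open>i+1\<close> is raised no later than \<open>i\<close>.\<close>
    have "{x \<in> F. x (i+1) = v (i+1)} \<subseteq> {x \<in> F. x i = v i}"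
    proof safe
      fix x assume x: "x \<in> F" "x (i+1) = v (i+1)"
      have "x i \<le> x (i+1)" using F x(1) i(1) by (auto simp: W_def)
      then show "x i = v i" using x i v_le(1)[OF x(1), of i] by simp
    qed
    then have "\<tau> (i+1) \<le> \<tau> i" using fin unfolding \<tau>_def by (intro card_mono) auto
    then have "int k * int (\<tau> (i+1)) \<le> int k * int (\<tau> i)" by (intro mult_left_mono) auto
    then have less: "\<kappa> i < \<kappa> (i+1)" by (simp add: \<kappa>_def)
    show "inv \<pi> i < inv \<pi> (i+1)"
    proof (rule ccontr)
      assume n: "\<not> ?thesis"
      have "inv \<pi> i \<in> {1..k-1}" "inv \<pi> (i+1) \<in> {1..k-1}"
        using i permutes_in_image[OF permutes_inv[OF \<pi>]] by auto
      moreover have "inv \<pi> i \<noteq> inv \<pi> (i+1)"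
        using permutes_inverses(1)[OF \<pi>] by (metis add_cancel_right_right zero_neq_one)
      ultimately have "\<kappa> (\<pi> (inv \<pi> (i+1))) < \<kappa> (\<pi> (inv \<pi> i))"
        using n sorted by auto
      then show False using less by (simp add: permutes_inverses(1)[OF \<pi>])
    qed
  qed
  have "x \<in> facet k v \<pi>" if x: "x \<in> F" for x
  proof -
    define U where "U = {j. x j \<noteq> v j}"
    have U1: "U \<subseteq> {1..k-1}"
      using x F(1) v by (fastforce simp: U_def W_def)
    have up: "j \<in> U" if ij: "i \<in> U" "j \<in> {1..k-1}" "\<kappa> i < \<kappa> j" for i j
    proof (rule ccontr)
      assume "j \<notin> U"
      then have xj: "x j = v j" and xi: "x i \<noteq> v i" using ij by (auto simp: U_def)
      \<comment> \<open>A \<open>y\<close> that has not raised \<open>i\<close> cannot be above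
        \<open>x\<close>, so it is below \<open>x\<close> and has not raised \<open>j\<close>
        either. The vertex \<open>x\<close> itself makes the inclusion strict.\<close>
      have "{y \<in> F. y i = v i} \<subset> {y \<in> F. y j = v j}"
      proof (intro psubsetI subsetI)
        fix y assume y: "y \<in> {y \<in> F. y i = v i}"
        then have "y i < x i" using xi v_le(1)[OF x, of i] by simp
        then have "\<not> x \<le> y" by (meson le_funD not_le)
        then have "y \<le> x" using cmp[OF x] y by blast
        then have "y j \<le> v j" using xj by (metis le_fun_def)
        then show "y \<in> {y \<in> F. y j = v j}" using y v_le(1)[of y j] by auto
      qed (use x xi xj in blast)
      then have "\<tau> i < \<tau> j" unfolding \<tau>_def using fin by (intro psubset_card_mono) auto
      moreover have "\<tau> j \<le> \<tau> i" using \<tau>_le[of i j] U1 ij by auto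
      ultimately show False by simp
    qed
    have "\<exists>m\<le>k-1. U = \<pi> ` {k-m..k-1}"
    proof (rule sorted_up_set_is_suffix[where \<kappa> = \<kappa>, OF k1 \<pi> _ U1])
      show "\<kappa> (\<pi> i) < \<kappa> (\<pi> j)" if "i \<in> {1..k-1}" "j \<in> {1..k-1}" "i < j" for i j
        using that by (rule sorted)
      show "j \<in> U" if "i \<in> U" "j \<in> {1..k-1}" "\<kappa> i < \<kappa> j" for i j
        using that by (rule up)
    qed
    then obtain m where m: "m \<le> k - 1" "U = \<pi> ` {k-m..k-1}" by blast
    have "x j = v j + (if j \<in> U then 1 else 0)" for j
      using v_le[OF x, of j] by (auto simp: U_def)
    then have "x = facet_vertex k v \<pi> m"
      unfolding facet_vertex_eq[OF k1 \<pi> m(1)] m(2) by blast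
    then show ?thesis using m(1) by (auto simp: facet_def)
  qed
  then show ?thesis
    unfolding T_def using v cons consistent_facet_in_W[OF k v vq cons] by blast
qed

lemma T_eq_clique_complex:
  assumes k: "k \<ge> 2" and q: "q \<ge> 1"
  shows "T k q = clique_complex (W k q) (compat k)"
proof (intro subset_antisym T_imp_clique subsetI)
  show "k \<ge> 1" using k by simp
next
  fix F assume F: "F \<in> clique_complex (W k q) (compat k)"
  show "F \<in> T k q"
  proof (cases "F = {}")
    case True
    \<comment> \<open>The empty clique has no least vertex to build a facet from, so it is obtained
      as a subset of another face.\<close>
    have "{\<lambda>_. 0} \<in> T k q"
      by (rule clique_imp_T[OF k q]) (auto simp: W_def compat_def)
    then show ?thesis using True by (auto simp: T_def)
  next
    case False
    then show ?thesis using F by (intro clique_imp_T[OF k q]) (auto simp: clique_complex_def)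
  qed
qed

subsection \<open>The gaps of a face\<close>

lemma ex_chain_enumeration:
  fixes F :: "'a::order set"
  assumes "finite F" "\<And>x y. x \<in> F \<Longrightarrow> y \<in> F \<Longrightarrow> x \<le> y \<or> y \<le> x"
  shows "\<exists>f. f ` {..<card F} = F \<and> (\<forall>i j. i < j \<longrightarrow> j < card F \<longrightarrow> f i < f j)"
  using assms
proof (induction "card F" arbitrary: F)
  case 0
  then show ?case by auto
next
  case (Suc n)
  then have "F \<noteq> {}" by auto
  then obtain m where m: "m \<in> F" "\<And>b. b \<in> F \<Longrightarrow> m \<le> b \<Longrightarrow> m = b"
    using finite_has_maximal[OF Suc.prems(1)] by blast
  have less: "y < m" if "y \<in> F - {m}" for y
    using Suc.prems(2)[of m y] m that by (auto simp: order.strict_iff_order)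
  have n: "card (F - {m}) = n" using Suc.hyps(2) m(1) Suc.prems(1) by simp
  obtain f where f: "f ` {..<n} = F - {m}" "\<And>i j. i < j \<Longrightarrow> j < n \<Longrightarrow> f i < f j"
    using Suc.hyps(1)[OF n[symmetric]] Suc.prems n by auto
  have "(f(n := m)) ` {..<Suc n} = F"
    using f(1) m(1) by (auto simp: lessThan_Suc)
  moreover have "(f(n := m)) i < (f(n := m)) j" if "i < j" "j < Suc n" for i j
    using that f less by (cases "j = n") auto
  ultimately show ?case unfolding Suc.hyps(2)[symmetric] by blast
qed

text \<open>The chain \<open>f 0 < \<dots> < f (t-1)\<close> is closed up to a periodic one by \<open>f t = f 0 + 1\<close>; each link vertex
  then lies, up to translation by the all-one vector, strictly inside a unique gap of the chain.\<close>

locale closed_chain =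
  fixes k q t :: nat and f :: "nat \<Rightarrow> nat \<Rightarrow> int"
  assumes k: "k \<ge> 2" and q: "q \<ge> 1"
    and W: "\<And>i. i < t \<Longrightarrow> f i \<in> W k q"
    and t: "t \<ge> 1"
    and last: "f t = (\<lambda>j. f 0 j + (if j < k then 1 else 0))"
    and mono: "\<And>i i' j. i \<le> i' \<Longrightarrow> i' \<le> t \<Longrightarrow> f i j \<le> f i' j"
    and strict: "\<And>i. i < t \<Longrightarrow> f i \<noteq> f (Suc i)"
begin

definition block :: "nat \<Rightarrow> nat set" where
  "block i = {j. j < k \<and> f i j \<noteq> f (Suc i) j}"

text \<open>An edge marks an inequality without slack at \<open>f i\<close>: raising its tail forces
  raising its head.\<close>

definition tight :: "nat \<Rightarrow> (nat \<times> nat) set" where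
  "tight i = {(j, nxt k j) | j. j \<in> block i \<and> f i j = f i (nxt k j) + wrap k q j}"

abbreviation gap :: "nat \<Rightarrow> nat set set" where
  "gap i \<equiv> up_sets (block i) (tight i)"

definition raise :: "nat \<Rightarrow> nat set \<Rightarrow> nat \<Rightarrow> int" where
  "raise i S = (\<lambda>j. f i j + (if j \<in> S then 1 else 0))"

lemma k0: "0 < k"
  using k by simp

lemma last_eq: "j < k \<Longrightarrow> f t j = f 0 j + 1"
  by (simp add: last)

lemma support: "i \<le> t \<Longrightarrow> j \<ge> k \<Longrightarrow> f i j = 0"
proof -
  assume "i \<le> t" "j \<ge> k"
  moreover have "f 0 j = 0" if "j \<ge> k" using W[of 0] t that k by (auto simp: W_def)
  moreover have "f i j = 0" if "i < t" "j \<ge> k" using W[of i] that k by (auto simp: W_def)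
  ultimately show ?thesis by (cases "i = t") (auto simp: last)
qed

lemma f_at_0: "i < t \<Longrightarrow> f i 0 = 0"
  using W by (auto simp: W_def)

lemma cyclic_mono_f: "i \<le> t \<Longrightarrow> cyclic_mono k q (f i)"
proof (cases "i = t")
  case True
  have "cyclic_mono k q (f 0)" using W[of 0] t W_iff[OF k] by auto
  then show ?thesis using k0 by (simp add: True cyclic_mono_def last nxt_less)
next
  case False
  assume "i \<le> t"
  then show ?thesis using False W[of i] W_iff[OF k] by auto
qed

lemma le_Suc_1: "i \<le> i' \<Longrightarrow> i' \<le> t \<Longrightarrow> j < k \<Longrightarrow> f i' j \<le> f i j + 1"
  using mono[of i' t j] mono[of 0 i j] last_eq[of j] by simp

lemma f_Suc: "i < t \<Longrightarrow> j < k \<Longrightarrow> f (Suc i) j = f i j + (if j \<in> block i then 1 else 0)"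
  using mono[of i "Suc i" j] le_Suc_1[of i "Suc i" j] by (auto simp: block_def)

lemma block_less: "j \<in> block i \<Longrightarrow> j < k"
  by (simp add: block_def)

lemma finite_block: "finite (block i)"
  by (rule finite_subset[of _ "{..<k}"]) (auto simp: block_def)

lemma block_ne: "i < t \<Longrightarrow> block i \<noteq> {}"
proof
  assume i: "i < t" "block i = {}"
  then have "f i j = f (Suc i) j" for j
    using support[of i j] support[of "Suc i" j] by (cases "j < k") (auto simp: block_def)
  then show False using strict[OF i(1)] by blast
qed

text \<open>Step \<open>i\<close> adds \<open>card (block i)\<close> to the coordinate sum; the
  steps telescope to the difference of \<open>f t\<close> and \<open>f 0\<close>, which is one in
  each of \<open>k\<close> coordinates.\<close>

lemma sum_card_block: "(\<Sum>i<t. card (block i)) = k"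
proof -
  have "int (card (block i)) = (\<Sum>j<k. f (Suc i) j) - (\<Sum>j<k. f i j)" if "i < t" for i
  proof -
    have "(\<Sum>j<k. f (Suc i) j) - (\<Sum>j<k. f i j) = (\<Sum>j<k. if j \<in> block i then 1 else 0)"
      unfolding sum_subtractf[symmetric] by (rule sum.cong) (use that in \<open>auto simp: f_Suc\<close>)
    also have "\<dots> = int (card ({..<k} \<inter> block i))"
      by (simp add: sum.If_cases Int_def)
    also have "{..<k} \<inter> block i = block i" using block_less by auto
    finally show ?thesis by simp
  qed
  then have "(\<Sum>i<t. int (card (block i))) = (\<Sum>i<t. (\<Sum>j<k. f (Suc i) j) - (\<Sum>j<k. f i j))"
    by (intro sum.cong) auto
  also have "\<dots> = (\<Sum>j<k. f t j) - (\<Sum>j<k. f 0 j)"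
    by (rule sum_lessThan_telescope)
  also have "\<dots> = int k"
    unfolding sum_subtractf[symmetric] by (simp add: last_eq)
  finally show ?thesis by (metis of_nat_eq_iff of_nat_sum)
qed

text \<open>Equality all the way round would make the coordinates constant, and the closing equality
  would then give \<open>q = 0\<close>.\<close>

lemma ex_not_tight:
  assumes i: "i < t"
  shows "\<exists>e<k. f i e \<noteq> f i (nxt k e) + wrap k q e"
proof (rule ccontr)
  assume "\<not> ?thesis"
  then have eq: "\<And>j. j < k \<Longrightarrow> f i j = f i (nxt k j) + wrap k q j" by blast
  have const: "j < k \<Longrightarrow> f i j = f i 0" for j
  proof (induction j)
    case (Suc j)
    then show ?case using eq[of j] by (simp add: nxt_def wrap_def)
  qed simp
  show False using eq[of "k-1"] const[of "k-1"] k q by (simp add: nxt_def wrap_def)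
qed

lemma acyclic_tight:
  assumes i: "i < t"
  shows "acyclic (tight i)"
proof -
  obtain e where e: "e < k" "f i e \<noteq> f i (nxt k e) + wrap k q e"
    using ex_not_tight[OF i] by blast
  \<comment> \<open>The cycle is cut after the slack index \<open>e\<close>; \<open>rank\<close>
    numbers the resulting path from the successor of \<open>e\<close> up to
    \<open>e\<close>.\<close>
  define rank where "rank = (\<lambda>j. if j \<le> e then j + k else j)"
  have "rank x < rank y" if "(x, y) \<in> tight i" for x y
  proof -
    have "x < k" "y = nxt k x" "x \<noteq> e" using that e by (auto simp: tight_def block_def)
    then show ?thesis using e(1) by (auto simp: rank_def nxt_def split: if_splits)
  qed
  then have "tight i \<subseteq> measure rank" by auto
  then show ?thesis by (meson wf_measure wf_subset wf_acyclic)
qed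

text \<open>Heads of edges stay in the block because \<open>f (Suc i)\<close> satisfies the same
  inequality with the tail already raised. Degrees are at most one because \<open>nxt k\<close> is
  an injective map on the indices below \<open>k\<close>.\<close>

lemma path_forest_block:
  assumes i: "i < t"
  shows "path_forest (block i) (tight i)"
proof
  show "tight i \<subseteq> block i \<times> block i"
  proof
    fix p assume "p \<in> tight i"
    then obtain j where j: "p = (j, nxt k j)" "j \<in> block i" "f i j = f i (nxt k j) + wrap k q j"
      by (auto simp: tight_def)
    have jk: "j < k" "nxt k j < k" using j(2) block_less nxt_less[OF k0] by auto
    have "f (Suc i) j \<le> f (Suc i) (nxt k j) + wrap k q j"
      using cyclic_mono_f[of "Suc i"] i jk by (auto simp: cyclic_mono_def)
    then have "nxt k j \<in> block i"
      using f_Suc[OF i jk(1)] f_Suc[OF i jk(2)] j by (auto split: if_splits)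
    then show "p \<in> block i \<times> block i" using j by simp
  qed
  show "single_valued (tight i)" by (auto simp: tight_def single_valued_def)
  show "single_valued ((tight i)\<inverse>)"
    using nxt_inj[OF block_less block_less] by (auto simp: tight_def single_valued_def)
qed (use finite_block acyclic_tight[OF i] in auto)

text \<open>Over the integers an inequality with slack survives raising one side by one; a tight one
  fails exactly when the tail is raised without the head.\<close>

lemma gap_iff:
  assumes i: "i < t" and S: "S \<subseteq> block i"
  shows "S \<in> gap i \<longleftrightarrow> cyclic_mono k q (raise i S)"
proof
  assume gap: "S \<in> gap i"
  show "cyclic_mono k q (raise i S)"
    unfolding cyclic_mono_def
  proof (intro allI impI)
    fix j assume j: "j < k"
    have le: "f i j \<le> f i (nxt k j) + wrap k q j"
      using cyclic_mono_f[of i] i j by (auto simp: cyclic_mono_def)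
    have "nxt k j \<in> S" if "j \<in> S" "f i j = f i (nxt k j) + wrap k q j"
    proof -
      have "(j, nxt k j) \<in> tight i" using that S by (auto simp: tight_def)
      then show ?thesis using gap that by (auto simp: up_sets_def)
    qed
    then show "raise i S j \<le> raise i S (nxt k j) + wrap k q j"
      using le by (cases "f i j = f i (nxt k j) + wrap k q j") (auto simp: raise_def)
  qed
next
  assume c: "cyclic_mono k q (raise i S)"
  have "y \<in> S" if "(x, y) \<in> tight i" "x \<in> S" for x y
  proof -
    have xy: "y = nxt k x" "f i x = f i y + wrap k q x" "x < k"
      using that by (auto simp: tight_def block_def)
    have "raise i S x \<le> raise i S y + wrap k q x" using c xy by (auto simp: cyclic_mono_def)
    then show ?thesis using xy(2) that(2) by (auto simp: raise_def split: if_splits)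
  qed
  then show "S \<in> gap i" using S by (auto simp: up_sets_def)
qed

section \<open>Link vertices as proper up-sets inside the gaps\<close>

definition cells :: "(nat \<times> nat set) set" where
  "cells = (SIGMA i:{..<t}. gap i - {{}, block i})"

text \<open>If \<open>0\<close> belongs to the raised set, coordinate \<open>0\<close> becomes one
  and normalising brings it back to zero. The empty set and the full block are not cells: they would
  give vertices of the face, \<open>f t\<close> normalising to \<open>f 0\<close>.\<close>

definition cell_vertex :: "nat \<times> nat set \<Rightarrow> nat \<Rightarrow> int" where
  "cell_vertex c = normalise k (raise (fst c) (snd c))"

lemma raise_bounds:
  assumes i: "i < t" and S: "S \<subseteq> block i" and j: "j < k"
  shows "f i j \<le> raise i S j" "raise i S j \<le> f (Suc i) j"
  using S f_Suc[OF i j] by (auto simp: raise_def)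

lemma raise_empty:
  assumes "\<And>j. j < k \<Longrightarrow> raise i S j = f i j" "S \<subseteq> block i"
  shows "S = {}"
proof -
  have "j \<notin> S" for j
    using assms(1)[of j] assms(2) block_less[of j i] by (auto simp: raise_def)
  then show ?thesis by blast
qed

lemma raise_block:
  assumes "i < t" "S \<subseteq> block i" "\<And>j. j < k \<Longrightarrow> raise i S j \<ge> f (Suc i) j"
  shows "S = block i"
proof -
  have "j \<in> S" if "j \<in> block i" for j
    using assms(3)[of j] f_Suc[OF assms(1), of j] block_less[OF that] that
    by (auto simp: raise_def split: if_splits)
  then show ?thesis using assms(2) by blast
qed

text \<open>Equal normal forms differ by a constant, and the bounds leave only the constants zero
  and one.\<close>

lemma normalise_eqD:
  assumes eq: "normalise k x = normalise k y"
    and le: "\<And>j. j < k \<Longrightarrow> x j \<le> y j" "\<And>j. j < k \<Longrightarrow> y j \<le> x j + 1"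
  shows "(\<forall>j<k. y j = x j) \<or> (\<forall>j<k. y j = x j + 1)"
proof -
  have "x j - x 0 = y j - y 0" if "j < k" for j
    using fun_cong[OF eq, of j] that by (simp add: normalise_def)
  then have "y j = x j + (y 0 - x 0)" if "j < k" for j using that by force
  moreover have "y 0 - x 0 = 0 \<or> y 0 - x 0 = 1" using le[OF k0] by linarith
  ultimately show ?thesis by (metis add.right_neutral)
qed

text \<open>Everything lies between \<open>f 0\<close> and \<open>f t\<close>, that is,
  \<open>f 0 + 1\<close> on the coordinates below \<open>k\<close>. So the upper bounds by one are
  automatic once the order along the chain is known.\<close>

lemma raise_between_f:
  assumes i: "i < t" and S: "S \<subseteq> block i" and j: "j < k"
  shows "i' \<le> i \<Longrightarrow> f i' j \<le> raise i S j" "i' \<le> i \<Longrightarrow> raise i S j \<le> f i' j + 1"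
    "i < i' \<Longrightarrow> i' \<le> t \<Longrightarrow> raise i S j \<le> f i' j" "i < i' \<Longrightarrow> i' \<le> t \<Longrightarrow> f i' j \<le> raise i S j + 1"
proof -
  note b = raise_bounds[OF i S j]
  show "i' \<le> i \<Longrightarrow> f i' j \<le> raise i S j" using mono[of i' i j] b i by simp
  show "i' \<le> i \<Longrightarrow> raise i S j \<le> f i' j + 1" using le_Suc_1[of i' "Suc i" j] b i j by simp
  show "i < i' \<Longrightarrow> i' \<le> t \<Longrightarrow> raise i S j \<le> f i' j" using mono[of "Suc i" i' j] b by simp
  show "i < i' \<Longrightarrow> i' \<le> t \<Longrightarrow> f i' j \<le> raise i S j + 1" using le_Suc_1[of i i' j] b j by simp
qed

lemma raise_between_raise:
  assumes i: "i < i'" "i' < t" and S: "S \<subseteq> block i" "S' \<subseteq> block i'" and j: "j < k"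
  shows "raise i S j \<le> raise i' S' j" "raise i' S' j \<le> raise i S j + 1"
proof -
  have i1: "i < t" "i' \<le> t" "i < Suc i'" "Suc i' \<le> t" using i by simp_all
  note b = raise_bounds[OF i(2) S(2) j]
  show "raise i S j \<le> raise i' S' j"
    using raise_between_f(3)[OF i1(1) S(1) j i(1) i1(2)] b(1) by linarith
  show "raise i' S' j \<le> raise i S j + 1"
    using raise_between_f(4)[OF i1(1) S(1) j i1(3,4)] b(2) by linarith
qed

text \<open>Elements witnessing incomparability would make the difference take both values 1 and
  -1.\<close>

lemma raise_compat_same:
  assumes S: "S \<subseteq> block i" "S' \<subseteq> block i"
  shows "compat k (raise i S) (raise i S') \<longleftrightarrow> S \<subseteq> S' \<or> S' \<subseteq> S"
proof
  assume "S \<subseteq> S' \<or> S' \<subseteq> S"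
  then show "compat k (raise i S) (raise i S')"
  proof
    assume "S \<subseteq> S'"
    then show ?thesis by (intro compat_between) (auto simp: raise_def)
  next
    assume "S' \<subseteq> S"
    then show ?thesis by (intro compat_sym[OF compat_between]) (auto simp: raise_def)
  qed
next
  assume c: "compat k (raise i S) (raise i S')"
  show "S \<subseteq> S' \<or> S' \<subseteq> S"
  proof (rule ccontr)
    assume "\<not> ?thesis"
    then obtain x y where "x \<in> S" "x \<notin> S'" "y \<in> S'" "y \<notin> S" by blast
    moreover from this have "x < k" "y < k" using S block_less by blast+
    then have "(raise i S x - raise i S' x) - (raise i S y - raise i S' y) \<le> 1"
      using c by (simp add: compat_def)
    ultimately show False by (simp add: raise_def)
  qed
qed

lemma normalise_f: "i < t \<Longrightarrow> normalise k (f i) = f i"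
  using normalise_id[OF k W] .

lemma cell_vertex_compat:
  assumes "c \<in> cells" "c' \<in> cells"
  shows "compat k (cell_vertex c) (cell_vertex c') \<longleftrightarrow>
    (fst c = fst c' \<longrightarrow> snd c \<subseteq> snd c' \<or> snd c' \<subseteq> snd c)"
proof -
  obtain i S i' S' where c: "c = (i, S)" "c' = (i', S')" by (cases c, cases c')
  have i: "i < t" "i' < t" and S: "S \<subseteq> block i" "S' \<subseteq> block i'"
    using assms by (auto simp: c cells_def up_sets_def)
  have less: "compat k (raise i S) (raise i' S')" if "i < i'" "i' < t" "S \<subseteq> block i" "S' \<subseteq> block i'"
    for i i' S S'
    using raise_between_raise[OF that] by (rule compat_between)
  have "compat k (raise i S) (raise i' S') \<longleftrightarrow> (i = i' \<longrightarrow> S \<subseteq> S' \<or> S' \<subseteq> S)"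
  proof (cases i i' rule: linorder_cases)
    case ii': less
    then show ?thesis using less[of i i' S S'] i S by simp
  next
    case equal
    then show ?thesis using raise_compat_same S by simp
  next
    case greater
    then show ?thesis using compat_sym[OF less[of i' i S' S]] i S by simp
  qed
  then show ?thesis
    by (simp add: c cell_vertex_def compat_normalise compat_normalise2 k0)
qed

lemma inj_cell_vertex: "inj_on cell_vertex cells"
proof (rule inj_onI)
  fix c c' assume cells: "c \<in> cells" "c' \<in> cells" and eq: "cell_vertex c = cell_vertex c'"
  obtain i S i' S' where c: "c = (i, S)" "c' = (i', S')" by (cases c, cases c')
  have i: "i < t" "i' < t" and S: "S \<subseteq> block i" "S' \<subseteq> block i'"
    and proper: "S \<noteq> {}" "S \<noteq> block i" "S' \<noteq> {}" "S' \<noteq> block i'"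
    using cells by (auto simp: c cells_def up_sets_def)
  have eq: "normalise k (raise i S) = normalise k (raise i' S')"
    using eq by (simp add: c cell_vertex_def)
  \<comment> \<open>Vectors from different gaps can only differ by zero or one. Difference zero
    pushes the lower one up to \<open>f (Suc i)\<close>, so \<open>S\<close> is full; difference one
    pushes the upper one up to \<open>f t\<close>, so \<open>S'\<close> is full.\<close>
  have no: False if i: "i < i'" "i' < t" and S: "S \<subseteq> block i" "S' \<subseteq> block i'"
    and proper: "S \<noteq> block i" "S' \<noteq> block i'"
    and eq: "normalise k (raise i S) = normalise k (raise i' S')" for i i' S S'
  proof -
    have i1: "i < t" using i by simp
    consider "\<And>j. j < k \<Longrightarrow> raise i' S' j = raise i S j" | "\<And>j. j < k \<Longrightarrow> raise i' S' j = raise i S j + 1"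
      using normalise_eqD[OF eq raise_between_raise[OF i S]] by blast
    then show False
    proof cases
      case 1
      have "f (Suc i) j \<le> raise i S j" if "j < k" for j
        using 1[OF that] raise_between_f(1)[OF i(2) S(2) that, of "Suc i"] i by simp
      then show False using raise_block[OF i1 S(1)] proper by blast
    next
      case 2
      have "f (Suc i') j \<le> raise i' S' j" if "j < k" for j
        using 2[OF that] raise_between_f(1)[OF i1 S(1) that, of 0] last_eq[OF that]
          mono[of "Suc i'" t j] i by simp
      then show False using raise_block[OF i(2) S(2)] proper by blast
    qed
  qed
  have "i = i'"
    using no[of i i' S S'] no[of i' i S' S] i S proper eq by (metis linorder_neqE_nat)
  have same: "S \<subseteq> S'" if S: "S \<subseteq> block i" "S' \<subseteq> block i" and proper: "S \<noteq> block i" "S' \<noteq> {}"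
    and eq: "normalise k (raise i S) = normalise k (raise i S')" for S S'
  proof
    fix x assume x: "x \<in> S"
    \<comment> \<open>In one gap the indicators of \<open>S\<close> and \<open>S'\<close> differ by
      a constant. The point \<open>z\<close> outside \<open>S\<close> shows that it is not positive,
      so \<open>x\<close> cannot lie in \<open>S\<close> alone.\<close>
    obtain z where z: "z \<in> block i" "z \<notin> S" using S proper by blast
    have xz: "x < k" "z < k" using x z S block_less by blast+
    have d: "raise i S j - raise i S 0 = raise i S' j - raise i S' 0" if "j < k" for j
      using fun_cong[OF eq, of j] that by (simp add: normalise_def)
    show "x \<in> S'"
      using d[OF xz(1)] d[OF xz(2)] x z by (simp add: raise_def split: if_splits)
  qed
  have "S \<subseteq> S'" "S' \<subseteq> S"
    using S proper eq unfolding \<open>i = i'\<close>[symmetric] by - (rule same; simp)+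
  then have "S = S'" by simp
  then show "c = c'" using \<open>i = i'\<close> by (simp add: c)
qed

text \<open>If the vertex were some \<open>f i'\<close>, the raised vector would differ from
  \<open>f i'\<close> by a constant. This forces \<open>S\<close> to be empty or full, except when
  \<open>f i'\<close> is the larger by one, which coordinate \<open>0\<close> rules out.\<close>

lemma cell_vertex_in_link:
  assumes "c \<in> cells"
  shows "cell_vertex c \<in> W k q" "cell_vertex c \<notin> f ` {..<t}"
    "i' < t \<Longrightarrow> compat k (cell_vertex c) (f i')"
proof -
  obtain i S where c: "c = (i, S)" by (cases c)
  have i: "i < t" and gap: "S \<in> gap i" and S: "S \<subseteq> block i" and proper: "S \<noteq> {}" "S \<noteq> block i"
    using assms by (auto simp: c cells_def up_sets_def)
  show "cell_vertex c \<in> W k q"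
    using gap gap_iff[OF i S] by (simp add: c cell_vertex_def normalise_W[OF k])
  have "compat k (raise i S) (f i')" if "i' < t" for i'
  proof (cases "i' \<le> i")
    case True
    have "compat k (f i') (raise i S)"
      using raise_between_f(1,2)[OF i S _ True] by (rule compat_between)
    then show ?thesis by (rule compat_sym)
  next
    case False
    then have "i < i'" "i' \<le> t" using that by simp_all
    then show ?thesis using raise_between_f(3,4)[OF i S] by (intro compat_between)
  qed
  then show "i' < t \<Longrightarrow> compat k (cell_vertex c) (f i')"
    by (simp add: c cell_vertex_def compat_normalise k0)
  show "cell_vertex c \<notin> f ` {..<t}"
  proof
    assume "cell_vertex c \<in> f ` {..<t}"
    then obtain i' where i': "i' < t" and eq: "normalise k (raise i S) = normalise k (f i')"
      using normalise_f by (auto simp: c cell_vertex_def)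
    show False
    proof (cases "i' \<le> i")
      case True
      consider "\<And>j. j < k \<Longrightarrow> raise i S j = f i' j" | "\<And>j. j < k \<Longrightarrow> raise i S j = f i' j + 1"
        using normalise_eqD[OF eq[symmetric] raise_between_f(1,2)[OF i S _ True]] by blast
      then show False
      proof cases
        case 1
        have "raise i S j = f i j" if "j < k" for j
          using 1[OF that] raise_bounds[OF i S that] mono[OF True, of j] i by simp
        then show False using raise_empty[OF _ S] proper by blast
      next
        case 2
        have "f (Suc i) j \<le> raise i S j" if "j < k" for j
          using 2[OF that] last_eq[OF that] mono[of 0 i' j] mono[of "Suc i" t j] i i' by simp
        then show False using raise_block[OF i S] proper by blast
      qed
    next
      case False
      then have ii': "i < i'" "i' \<le> t" using i' by simp_all
      consider "\<And>j. j < k \<Longrightarrow> f i' j = raise i S j" | "\<And>j. j < k \<Longrightarrow> f i' j = raise i S j + 1"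
        using normalise_eqD[OF eq raise_between_f(3,4)[OF i S _ ii']] by blast
      then show False
      proof cases
        case 1
        have "f (Suc i) j \<le> raise i S j" if "j < k" for j
          using 1[OF that] mono[of "Suc i" i' j] ii' by simp
        then show False using raise_block[OF i S] proper by blast
      next
        case 2
        then show False using f_at_0[OF i'] f_at_0[OF i] raise_bounds(1)[OF i S k0] k0 by force
      qed
    qed
  qed
qed

text \<open>The vectors between \<open>f 0\<close> and its translate \<open>f t\<close> form a
  window of height one: \<open>x\<close> itself is the lift if it lies above \<open>f 0\<close>, and
  otherwise \<open>x + 1\<close> is.\<close>

lemma ex_lift:
  assumes x: "x \<in> W k q" "\<And>i. i < t \<Longrightarrow> compat k x (f i)"
  shows "\<exists>y. normalise k y = x \<and> (\<forall>j<k. f 0 j \<le> y j) \<and> \<not> (\<forall>j<k. f t j \<le> y j)"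
proof (cases "f 0 \<le> x")
  case True
  have "f t 0 = 1" "x 0 = 0" using last_eq[OF k0] f_at_0[of 0] t x(1) by (auto simp: W_def)
  then show ?thesis
    using True normalise_id[OF k x(1)] k0 by (intro exI[of _ x]) (force simp: le_fun_def)
next
  case False
  have c: "compat k x (f 0)" "f 0 \<in> W k q" using x(2)[of 0] W[of 0] t by auto
  have le: "x \<le> f 0" "f 0 j \<le> x j + 1" for j
    using compat_comparable[OF k x(1) c(2,1)] compat_comparable(2)[OF k c(2) x(1) compat_sym[OF c(1)]]
      False by auto
  define y where "y = (\<lambda>j. x j + 1)"
  have "normalise k y = normalise k x" by (simp add: y_def normalise_def fun_eq_iff)
  moreover have "\<not> (\<forall>j<k. f t j \<le> y j)"
  proof
    assume "\<forall>j<k. f t j \<le> y j"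
    then have "f 0 j \<le> x j" for j
      using last_eq[of j] c(2) x(1) k by (cases "j < k") (auto simp: y_def W_def)
    then show False using False by (simp add: le_fun_def)
  qed
  ultimately show ?thesis
    using normalise_id[OF k x(1)] le(2) by (intro exI[of _ y]) (auto simp: y_def)
qed

lemma link_vertex_in_cell:
  assumes x: "x \<in> W k q" "x \<notin> f ` {..<t}" "\<And>i. i < t \<Longrightarrow> compat k x (f i)"
  shows "x \<in> cell_vertex ` cells"
proof -
  obtain y where y: "normalise k y = x" and y0: "\<And>j. j < k \<Longrightarrow> f 0 j \<le> y j"
    and yt: "\<not> (\<forall>j<k. f t j \<le> y j)"
    using ex_lift[OF x(1,3)] by blast
  \<comment> \<open>Being below \<open>y\<close> holds at index \<open>0\<close> and fails at
    \<open>t\<close>, so it is lost at some step.\<close>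
  have "\<exists>i<t. (\<forall>j<k. f i j \<le> y j) \<and> \<not> (\<forall>j<k. f (Suc i) j \<le> y j)"
  proof (rule ccontr)
    assume n: "\<not> ?thesis"
    have "i \<le> t \<Longrightarrow> \<forall>j<k. f i j \<le> y j" for i
    proof (induction i)
      case (Suc i)
      then show ?case using n Suc_le_lessD Suc_leD by blast
    qed (use y0 in blast)
    then show False using yt by blast
  qed
  then obtain i where i: "i < t" and lo: "\<And>j. j < k \<Longrightarrow> f i j \<le> y j"
    and "\<not> (\<forall>j<k. f (Suc i) j \<le> y j)" by blast
  then obtain l where l: "l < k" "y l < f (Suc i) l" by (auto simp: not_le)
  have "compat k x (f (Suc i))"
  proof (cases "Suc i = t")
    case True
    \<comment> \<open>\<open>f t\<close> and \<open>f 0\<close> differ by a constant on the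
      coordinates below \<open>k\<close>, which \<open>compat\<close> does not see.\<close>
    have "compat k x (f 0)" using x(3) t by simp
    then show ?thesis
      unfolding compat_def True using last_eq by (smt (verit))
  next
    case False
    then show ?thesis using x(3) i by simp
  qed
  then have cmp: "compat k y (f (Suc i))"
    unfolding y[symmetric] by (simp add: compat_normalise k0)
  \<comment> \<open>At \<open>l\<close> the vector \<open>y\<close> is strictly below
    \<open>f (Suc i)\<close>, so with oscillation at most one it is nowhere strictly above.\<close>
  have hi: "y j \<le> f (Suc i) j" if "j < k" for j
    using cmp l that unfolding compat_def by (smt (verit))
  define S where "S = {j. j < k \<and> f i j < y j}"
  have S: "S \<subseteq> block i" using hi by (fastforce simp: S_def block_def)
  have raise: "raise i S j = y j" if "j < k" for j
    using lo[OF that] hi[OF that] f_Suc[OF i that] that by (auto simp: raise_def S_def split: if_splits)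
  have vertex: "cell_vertex (i, S) = x"
    using raise k0 by (simp add: cell_vertex_def normalise_def fun_eq_iff flip: y)
  have "cyclic_mono k q y"
    using x(1) unfolding y[symmetric] normalise_W[OF k] .
  then have "cyclic_mono k q (raise i S)"
    using cyclic_mono_cong[where x = "raise i S" and y = y, OF k0 raise] by simp
  then have "S \<in> gap i"
    using gap_iff[OF i S] by simp
  moreover have "S \<noteq> {}"
  proof
    assume "S = {}"
    then have "x = f i" using vertex normalise_f[OF i] by (simp add: cell_vertex_def raise_def)
    then show False using x(2) i by blast
  qed
  moreover have "S \<noteq> block i"
  proof
    assume "S = block i"
    then have "f (Suc i) l = raise i S l" using f_Suc[OF i l(1)] by (simp add: raise_def)
    then show False using raise[OF l(1)] l(2) by simp
  qed
  ultimately have "(i, S) \<in> cells" using i by (simp add: cells_def)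
  then show ?thesis using vertex by blast
qed

lemma bij_cell_vertex:
  "bij_betw cell_vertex cells {x \<in> W k q. x \<notin> f ` {..<t} \<and> (\<forall>y\<in>f ` {..<t}. compat k x y)}"
  unfolding bij_betw_def
proof (intro conjI inj_cell_vertex subset_antisym subsetI)
  fix x assume "x \<in> cell_vertex ` cells"
  then obtain c where "c \<in> cells" "x = cell_vertex c" by blast
  then show "x \<in> {x \<in> W k q. x \<notin> f ` {..<t} \<and> (\<forall>y\<in>f ` {..<t}. compat k x y)}"
    using cell_vertex_in_link(1,2)[of c] cell_vertex_in_link(3)[of c] by fast
next
  fix x assume "x \<in> {x \<in> W k q. x \<notin> f ` {..<t} \<and> (\<forall>y\<in>f ` {..<t}. compat k x y)}"
  then show "x \<in> cell_vertex ` cells"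
    by (intro link_vertex_in_cell) auto
qed

end

section \<open>Assembling the isomorphism with the join\<close>

lemma ex_descending_order:
  fixes g :: "nat \<Rightarrow> nat"
  shows "\<exists>idx. set idx = {..<t} \<and> distinct idx \<and> length idx = t \<and> sorted_wrt (\<ge>) (map g idx)"
proof -
  define idx where "idx = rev (sort_key g [0..<t])"
  have "sorted (map g (sort_key g [0..<t]))" by simp
  then have "sorted_wrt (\<ge>) (map g idx)"
    unfolding idx_def by (simp add: rev_map[symmetric] sorted_wrt_rev)
  then show ?thesis by (intro exI[of _ idx]) (auto simp: idx_def)
qed

lemma bij_betw_Sigma:
  assumes f: "bij_betw f A A'" and g: "\<And>x. x \<in> A \<Longrightarrow> bij_betw (g x) (B x) (B' (f x))"
  shows "bij_betw (\<lambda>(x, y). (f x, g x y)) (Sigma A B) (Sigma A' B')"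
  unfolding bij_betw_def
proof (intro conjI inj_onI subset_antisym subsetI)
  fix p p' assume "p \<in> Sigma A B" "p' \<in> Sigma A B" "(case p of (x, y) \<Rightarrow> (f x, g x y)) = (case p' of (x, y) \<Rightarrow> (f x, g x y))"
  then show "p = p'"
    using f g by (auto simp: bij_betw_def dest: inj_onD)
next
  fix p assume "p \<in> (\<lambda>(x, y). (f x, g x y)) ` Sigma A B"
  then show "p \<in> Sigma A' B'"
    using f g by (auto simp: bij_betw_def)
next
  fix p assume "p \<in> Sigma A' B'"
  then obtain a b where p: "p = (a, b)" "a \<in> A'" "b \<in> B' a" by blast
  obtain x where x: "x \<in> A" "a = f x" using f p(2) by (auto simp: bij_betw_def)
  obtain y where "y \<in> B x" "b = g x y" using g[OF x(1)] p(3) x(2) by (auto simp: bij_betw_def)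
  then show "p \<in> (\<lambda>(x, y). (f x, g x y)) ` Sigma A B" using p(1) x by force
qed

context closed_chain
begin

lemma link_iso_join:
  assumes face: "f ` {..<t} \<in> T k q"
  shows "\<exists>lam sig. is_partition lam k \<and> length lam = t \<and> length sig = t \<and>
     (\<forall>i<t. is_partition (sig ! i) (lam ! i)) \<and>
     link (T k q) (f ` {..<t}) \<cong>\<^sub>c join_list (map K_part sig)"
proof -
  have "\<forall>i\<in>{..<t}. \<exists>\<sigma> h. is_partition \<sigma> (card (block i)) \<and> bij_betw h (gap i) (chain_product \<sigma>) \<and>
     (\<forall>S\<in>gap i. \<forall>S'\<in>gap i. S \<subseteq> S' \<longleftrightarrow> list_all2 (\<le>) (h S) (h S')) \<and>
     h {} = replicate (length \<sigma>) 0 \<and> h (block i) = \<sigma>"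
    using path_forest.up_sets_iso_chain_product[OF path_forest_block] by blast
  then obtain \<sigma> h where part: "\<And>i. i < t \<Longrightarrow> is_partition (\<sigma> i) (card (block i))"
    and h: "\<And>i. i < t \<Longrightarrow> bij_betw (h i) (gap i) (chain_product (\<sigma> i))"
    and le: "\<And>i S S'. i < t \<Longrightarrow> S \<in> gap i \<Longrightarrow> S' \<in> gap i \<Longrightarrow>
       S \<subseteq> S' \<longleftrightarrow> list_all2 (\<le>) (h i S) (h i S')"
    and h0: "\<And>i. i < t \<Longrightarrow> h i {} = replicate (length (\<sigma> i)) 0"
    and h1: "\<And>i. i < t \<Longrightarrow> h i (block i) = \<sigma> i"
    unfolding bchoice_iff by (elim exE) (simp only: lessThan_iff, blast)
  \<comment> \<open>The blocks come in the order of the chain; \<open>idx\<close> rearranges them by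
    descending size, as \<open>is_partition\<close> demands of \<open>lam\<close>.\<close>
  obtain idx where idx: "set idx = {..<t}" "distinct idx" "length idx = t"
    and desc: "sorted_wrt (\<ge>) (map (\<lambda>i. card (block i)) idx)"
    using ex_descending_order[of t "\<lambda>i. card (block i)"] by blast
  define lam where "lam = map (\<lambda>i. card (block i)) idx"
  define sig where "sig = map \<sigma> idx"
  have length_sig: "length sig = t" by (simp add: sig_def idx)
  have idx_t: "idx ! n < t" if "n < t" for n
    using nth_mem[of n idx] that idx by auto
  have bij_idx: "bij_betw ((!) idx) {..<t} {..<t}"
    using bij_betw_nth[OF idx(2)] idx by auto
  have "sum_list lam = k"
    unfolding lam_def using sum_card_block by (simp add: sum_list_distinct_conv_sum_set idx)
  then have lam: "is_partition lam k"
    using desc block_ne finite_block by (auto simp: is_partition_def lam_def idx card_gt_0_iff)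
  have sig: "\<forall>i<t. is_partition (sig ! i) (lam ! i)"
    using part idx_t by (simp add: sig_def lam_def idx)
  have hp: "bij_betw (h i) (gap i - {{}, block i}) (proper_part (\<sigma> i))" if i: "i < t" for i
  proof -
    have "{} \<in> gap i" "block i \<in> gap i"
      using path_forest.E_sub[OF path_forest_block[OF i]] by (auto simp: up_sets_def)
    moreover have inj: "inj_on (h i) (gap i)" and img: "h i ` gap i = chain_product (\<sigma> i)"
      using h[OF i] by (auto simp: bij_betw_def)
    ultimately have "h i ` (gap i - {{}, block i}) = chain_product (\<sigma> i) - h i ` {{}, block i}"
      using inj_on_image_set_diff[OF inj, of "gap i" "{{}, block i}"] by simp
    then have "bij_betw (h i) (gap i - {{}, block i}) (chain_product (\<sigma> i) - h i ` {{}, block i})"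
      using inj_on_diff[OF inj] by (intro bij_betw_imageI)
    then show ?thesis using h0[OF i] h1[OF i] by simp
  qed
  \<comment> \<open>\<open>D\<close> holds the cells under their new positions. It maps bijectively
    to the link vertices by \<open>\<phi>\<close> and to the join vertices by \<open>?label\<close>;
    adjacency is compared over \<open>D\<close>.\<close>
  define D where "D = (SIGMA n:{..<t}. gap (idx ! n) - {{}, block (idx ! n)})"
  have reindex: "bij_betw (\<lambda>(n, S). (idx ! n, S)) D cells"
    unfolding D_def cells_def by (rule bij_betw_Sigma[OF bij_idx]) (simp add: bij_betw_def)
  have label: "bij_betw (\<lambda>(n, S). (n, h (idx ! n) S)) D (SIGMA n:{..<t}. proper_part (sig ! n))"
    (is "bij_betw ?label D ?V'")
    unfolding D_def
  proof (rule bij_betw_Sigma[where f = "\<lambda>n. n"])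
    fix n assume "n \<in> {..<t}"
    then show "bij_betw (h (idx ! n)) (gap (idx ! n) - {{}, block (idx ! n)}) (proper_part (sig ! n))"
      using hp[OF idx_t] by (simp add: sig_def idx)
  qed (simp add: bij_betw_def)
  define V where "V = {x \<in> W k q. x \<notin> f ` {..<t} \<and> (\<forall>y\<in>f ` {..<t}. compat k x y)}"
  define \<phi> where "\<phi> = cell_vertex \<circ> (\<lambda>(n, S). (idx ! n, S))"
  have \<phi>: "bij_betw \<phi> D V"
    unfolding \<phi>_def V_def using reindex bij_cell_vertex by (rule bij_betw_trans)
  have rel: "tagged_comparable (?label c) (?label c') \<longleftrightarrow> compat k (\<phi> c) (\<phi> c')"
    if cD: "c \<in> D" "c' \<in> D" for c c'
  proof -
    obtain n S n' S' where c: "c = (n, S)" "c' = (n', S')" by (cases c, cases c')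
    have n: "n < t" "n' < t" and S: "S \<in> gap (idx ! n)" "S' \<in> gap (idx ! n')"
      using cD by (auto simp: c D_def)
    have "(idx ! n, S) \<in> cells" "(idx ! n', S') \<in> cells"
      using cD idx_t by (auto simp: c D_def cells_def)
    then have "compat k (\<phi> c) (\<phi> c') \<longleftrightarrow> (idx ! n = idx ! n' \<longrightarrow> S \<subseteq> S' \<or> S' \<subseteq> S)"
      using cell_vertex_compat by (simp add: c \<phi>_def)
    also have "idx ! n = idx ! n' \<longleftrightarrow> n = n'"
      using n idx by (simp add: nth_eq_iff_index_eq)
    also have "(n = n' \<longrightarrow> S \<subseteq> S' \<or> S' \<subseteq> S) \<longleftrightarrow> tagged_comparable (?label c) (?label c')"
    proof (cases "n = n'")
      case True
      then show ?thesis
        using le[OF idx_t[OF n(1)], of S S'] le[OF idx_t[OF n(1)], of S' S] S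
        by (simp add: c tagged_comparable_def)
    qed (simp add: c tagged_comparable_def)
    finally show ?thesis by simp
  qed
  have inv: "inv_into D ?label a \<in> D" "?label (inv_into D ?label a) = a" if "a \<in> ?V'" for a
  proof -
    have a: "a \<in> ?label ` D" using label that unfolding bij_betw_def by simp
    show "inv_into D ?label a \<in> D" using a by (rule inv_into_into)
    show "?label (inv_into D ?label a) = a" using a by (rule f_inv_into_f)
  qed
  have "clique_complex V (compat k) \<cong>\<^sub>c clique_complex ?V' tagged_comparable"
  proof (rule clique_complex_iso)
    show "bij_betw (\<phi> \<circ> inv_into D ?label) ?V' V"
      using bij_betw_inv_into[OF label] \<phi> by (rule bij_betw_trans)
    show "tagged_comparable a b \<longleftrightarrow>
        compat k ((\<phi> \<circ> inv_into D ?label) a) ((\<phi> \<circ> inv_into D ?label) b)"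
      if "a \<in> ?V'" "b \<in> ?V'" for a b
      using rel[OF inv(1) inv(1), OF that] unfolding inv(2)[OF that(1)] inv(2)[OF that(2)]
      by (simp only: o_apply)
  qed
  moreover have "link (T k q) (f ` {..<t}) = clique_complex V (compat k)"
    unfolding T_eq_clique_complex[OF k q] V_def
    by (rule link_clique_complex) (use face T_eq_clique_complex[OF k q] compat_sym in auto)
  ultimately have "link (T k q) (f ` {..<t}) \<cong>\<^sub>c join_list (map K_part sig)"
    by (simp add: join_K_part idx length_sig del: map_map)
  then show ?thesis
    using lam sig by (intro exI[of _ lam] exI[of _ sig]) (simp add: lam_def sig_def idx)
qed

end

theorem mainTheorem7:
  fixes k q t :: nat and F :: "(nat \<Rightarrow> int) set"
  assumes "k \<ge> 2" and "q \<ge> 1" and "t \<ge> 1"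
    and "F \<in> T k q" and "card F = t"
  shows "\<exists>(lam :: nat list) (sig :: nat list list).
           is_partition lam k \<and> length lam = t \<and>
           length sig = t \<and> (\<forall>i<t. is_partition (sig ! i) (lam ! i)) \<and>
           link (T k q) F \<cong>\<^sub>c join_list (map K_part sig)"
proof -
  note k = assms(1)
  have F: "F \<subseteq> W k q" "\<And>x y. x \<in> F \<Longrightarrow> y \<in> F \<Longrightarrow> compat k x y"
    using assms(4) by (auto simp: T_eq_clique_complex[OF assms(1,2)] clique_complex_def)
  have fin: "finite F" using F(1) finite_W[OF k] by (rule finite_subset)
  have cmp: "x \<le> y \<or> y \<le> x" if "x \<in> F" "y \<in> F" for x y
    using compat_comparable(1)[OF k _ _ F(2)[OF that]] F(1) that by blast
  obtain g where g: "g ` {..<t} = F" and less: "\<And>i j. i < j \<Longrightarrow> j < t \<Longrightarrow> g i < g j"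
    using ex_chain_enumeration[OF fin cmp] assms(5) by blast
  \<comment> \<open>The vertices of \<open>F\<close> use the indices below \<open>t\<close>; the
    value at \<open>t\<close> closes the chain.\<close>
  define f where "f = g(t := \<lambda>j. g 0 j + (if j < k then 1 else 0))"
  have gF: "g i \<in> F" if "i < t" for i using g that by auto
  have g_le: "g i j \<le> g i' j" if "i \<le> i'" "i' < t" for i i' j
    using less[of i i'] that by (cases "i = i'") (auto simp: le_fun_def less_fun_def)
  have g_last: "g i j \<le> g 0 j + (if j < k then 1 else 0)" if "i < t" for i j
  proof (cases "j < k")
    case True
    have "compat k (g i) (g 0)" "g i \<in> W k q" "g 0 \<in> W k q"
      using F gF that assms(3) by auto
    then show ?thesis using True compat_comparable(2)[OF k] by simp
  next
    case False
    have "g i \<in> W k q" "g 0 \<in> W k q" using F(1) gF that assms(3) by auto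
    moreover have "j \<notin> {1..k-1}" using False k by auto
    ultimately have "g i j = 0" "g 0 j = 0" unfolding W_def by blast+
    then show ?thesis by simp
  qed
  have "closed_chain k q t f"
  proof
    show "f i \<in> W k q" if "i < t" for i
      using that gF F(1) by (auto simp: f_def)
    show "f t = (\<lambda>j. f 0 j + (if j < k then 1 else 0))"
      using assms(3) by (simp add: f_def)
    show "f i j \<le> f i' j" if "i \<le> i'" "i' \<le> t" for i i' j
      using that g_le[of i i' j] g_last[of i j] by (cases "i' = t") (auto simp: f_def)
    show "f i \<noteq> f (Suc i)" if i: "i < t" for i
    proof (cases "Suc i = t")
      case True
      \<comment> \<open>The closing step is proper because it raises coordinate \<open>0\<close>,
        which is zero on all of \<open>F\<close>.\<close>
      have "f i 0 = 0" "f t 0 = 1"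
        using F(1) gF[OF i] gF[of 0] i k by (auto simp: f_def W_def)
      then show ?thesis unfolding True by (metis zero_neq_one)
    next
      case False
      then show ?thesis using less[of i "Suc i"] i by (simp add: f_def order.strict_implies_not_eq)
    qed
  qed (use assms in auto)
  moreover have "f ` {..<t} = F" using g by (auto simp: f_def)
  ultimately show ?thesis
    using closed_chain.link_iso_join[of k q t f] assms(4) by simp
qed

end
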